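(* Fix an integer $k\ge 1$, a vector $\mathbf{w}=[w_1,\dots,w_k]^\intercal\in\mathbb{R}^k$ with $w_i\neq 0$ for all $i$, and constants $\sigma_a,\sigma_z>0$. Let $$c(\mathbf{w}) = \min_{\emptyset\neq\mathcal{T}\subseteq[k]}\left[\frac{1}{2|\mathcal{T}|}\log\left(1+\frac{\sigma_a^2}{\sigma_z^2}\sum_{j\in\mathcal{T}}w_j^2\right)\right].$$ Let $(n_m)_{m\ge k}$ be a sequence of positive integers. If there exist a sequence of matrices $\{A^{(m)}\}_{m=k}^\infty$, $A^{(m)}\in\mathbb{R}^{n_m\times m}$, and a sequence of support recovery maps $\{d^{(m)}\}_{m=k}^\infty$, $d^{(m)}:\mathbb{R}^{n_m}\to 2^{[m]}$, such that $$\frac{1}{n_m m}\|A^{(m)}\|_F^2\le\sigma_a^2\quad\text{for all } m\ge k$$ and $$\lim_{m\to\infty}\overline{P}_e(\mathbf{w},A^{(m)})=0,$$ where $\overline{P}_e(\mathbf{w},A^{(m)})$ is the average probability of error of $d^{(m)}$, then $$\limsup_{m\to\infty}\frac{\log m}{n_m}\le c(\mathbf{w}).$$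
   Context: Notation: $[m]=\{1,\dots,m\}$, $2^{[m]}$ is the set of subsets of $[m]$, $\|\cdot\|_F$ is the Frobenius norm. The base of $\log$ is the same everywhere (and is then immaterial). Signal model: for $m\ge k$, $\mathbf{S}=(S_1,\dots,S_k)\in[m]^k$ is chosen uniformly at random from $[m]$ without replacement (uniform over ordered $k$-tuples of distinct elements). The signal $\mathbf{X}=\mathbf{X}(\mathbf{w},\mathbf{S})\in\mathbb{R}^m$ has $X_s=w_j$ if $s=S_j$, and $X_s=0$ if $s\notin\{S_1,\dots,S_k\}$; so $\mathrm{supp}(\mathbf{X})=\{S_1,\dots,S_k\}$. Measurement model: $\mathbf{Y}=A\mathbf{X}+\mathbf{Z}$ with $A\in\mathbb{R}^{n\times m}$ a fixed matrix and $\mathbf{Z}\in\mathbb{R}^n$ having i.i.d. $\mathcal{N}(0,\sigma_z^2)$ entries, independent of $\mathbf{S}$. Here $n=n_m$. A support recovery map is a (Borel measurable) map $d:\mathbb{R}^n\to 2^{[m]}$. Its average probability of error is $\overline{P}_e(\mathbf{w},A)=\mathsf{P}\{d(\mathbf{Y})\neq\mathrm{supp}(\mathbf{X}(\mathbf{w},\mathbf{S}))\}$, the probability being over $\mathbf{S}$ and $\mathbf{Z}$. *)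

theory Defs
  imports "HOL-Probability.Probability"
begin

text \<open>
  The dimensions n and m vary along a sequence, so they cannot be type indices. A vector in
  \<open>\<real>\<^sup>n\<close> is an extensional function on \<open>{1..n}\<close>, and the Borel sets are those of
  \<open>\<Pi>\<^sub>M i\<in>{1..n}. borel\<close>. An n-by-m matrix is a function \<open>A\<close> of which only the entries \<open>A i s\<close> with
  \<open>i \<in> {1..n}\<close> and \<open>s \<in> {1..m}\<close> are used; likewise \<open>w\<close> is used only on \<open>{1..k}\<close>.
\<close>

definition distinct_tuples :: "nat \<Rightarrow> nat \<Rightarrow> (nat \<Rightarrow> nat) set" where
  "distinct_tuples k m = {S \<in> {1..k} \<rightarrow>\<^sub>E {1..m}. inj_on S {1..k}}"

definition signal :: "nat \<Rightarrow> (nat \<Rightarrow> real) \<Rightarrow> (nat \<Rightarrow> nat) \<Rightarrow> nat \<Rightarrow> real" where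
  "signal k w S s = (if s \<in> S ` {1..k} then w (the_inv_into {1..k} S s) else 0)"

definition supp :: "nat \<Rightarrow> (nat \<Rightarrow> real) \<Rightarrow> nat set" where
  "supp m x = {s \<in> {1..m}. x s \<noteq> 0}"

definition measurement ::
    "nat \<Rightarrow> nat \<Rightarrow> (nat \<Rightarrow> nat \<Rightarrow> real) \<Rightarrow> (nat \<Rightarrow> real) \<Rightarrow> (nat \<Rightarrow> real) \<Rightarrow> nat \<Rightarrow> real" where
  "measurement n m A x z = (\<lambda>i\<in>{1..n}. (\<Sum>s\<in>{1..m}. A i s * x s) + z i)"

definition frobenius_norm :: "nat \<Rightarrow> nat \<Rightarrow> (nat \<Rightarrow> nat \<Rightarrow> real) \<Rightarrow> real" where
  "frobenius_norm n m A = sqrt (\<Sum>i\<in>{1..n}. \<Sum>s\<in>{1..m}. (A i s)\<^sup>2)"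

definition gaussian_noise :: "nat \<Rightarrow> real \<Rightarrow> (nat \<Rightarrow> real) measure" where
  "gaussian_noise n \<sigma> = (\<Pi>\<^sub>M i\<in>{1..n}. density lborel (\<lambda>x. ennreal (normal_density 0 \<sigma> x)))"

text \<open>The joint law of the independent pair (S, Z). The first factor lives on the finite set of
  tuples, rather than on the whole function type, so that the error event is measurable.\<close>

definition joint_law ::
    "nat \<Rightarrow> nat \<Rightarrow> nat \<Rightarrow> real \<Rightarrow> ((nat \<Rightarrow> nat) \<times> (nat \<Rightarrow> real)) measure" where
  "joint_law k n m \<sigma> = uniform_count_measure (distinct_tuples k m) \<Otimes>\<^sub>M gaussian_noise n \<sigma>"

definition support_recovery_map :: "nat \<Rightarrow> nat \<Rightarrow> ((nat \<Rightarrow> real) \<Rightarrow> nat set) \<Rightarrow> bool" where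
  "support_recovery_map n m d \<longleftrightarrow>
     d \<in> (\<Pi>\<^sub>M i\<in>{1..n}. borel) \<rightarrow>\<^sub>M count_space (Pow {1..m})"

definition error_event ::
    "nat \<Rightarrow> nat \<Rightarrow> nat \<Rightarrow> real \<Rightarrow> (nat \<Rightarrow> real) \<Rightarrow> (nat \<Rightarrow> nat \<Rightarrow> real) \<Rightarrow>
     ((nat \<Rightarrow> real) \<Rightarrow> nat set) \<Rightarrow> ((nat \<Rightarrow> nat) \<times> (nat \<Rightarrow> real)) set" where
  "error_event k n m \<sigma> w A d =
     {(S, Z) \<in> space (joint_law k n m \<sigma>).
        d (measurement n m A (signal k w S) Z) \<noteq> supp m (signal k w S)}"

definition avg_error_prob ::
    "nat \<Rightarrow> nat \<Rightarrow> nat \<Rightarrow> real \<Rightarrow> (nat \<Rightarrow> real) \<Rightarrow> (nat \<Rightarrow> nat \<Rightarrow> real) \<Rightarrow>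
     ((nat \<Rightarrow> real) \<Rightarrow> nat set) \<Rightarrow> real" where
  "avg_error_prob k n m \<sigma> w A d =
     measure (joint_law k n m \<sigma>) (error_event k n m \<sigma> w A d)"

text \<open>\<open>b\<close> is the base of the logarithm.\<close>

definition capacity_bound ::
    "real \<Rightarrow> nat \<Rightarrow> real \<Rightarrow> real \<Rightarrow> (nat \<Rightarrow> real) \<Rightarrow> real" where
  "capacity_bound b k \<sigma>\<^sub>a \<sigma>\<^sub>z w =
     Min ((\<lambda>T. 1 / (2 * real (card T)) * log b (1 + \<sigma>\<^sub>a\<^sup>2 / \<sigma>\<^sub>z\<^sup>2 * (\<Sum>j\<in>T. (w j)\<^sup>2)))
          ` {T. T \<noteq> {} \<and> T \<subseteq> {1..k}})"

lemma signal_at_tuple: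
  assumes "S \<in> distinct_tuples k m" "j \<in> {1..k}"
  shows "signal k w S (S j) = w j"
  using assms by (auto simp: signal_def distinct_tuples_def the_inv_into_f_f)

lemma supp_signal:
  assumes S: "S \<in> distinct_tuples k m" and w: "\<And>j. j \<in> {1..k} \<Longrightarrow> w j \<noteq> 0"
  shows "supp m (signal k w S) = S ` {1..k}"
proof
  show "supp m (signal k w S) \<subseteq> S ` {1..k}"
    by (auto simp: supp_def signal_def split: if_splits)
  show "S ` {1..k} \<subseteq> supp m (signal k w S)"
  proof
    fix s assume "s \<in> S ` {1..k}"
    then obtain j where j: "j \<in> {1..k}" "s = S j" by blast
    moreover have "S j \<in> {1..m}" using S j by (auto simp: distinct_tuples_def)
    ultimately show "s \<in> supp m (signal k w S)"
      using signal_at_tuple[OF S j(1)] w by (simp add: supp_def)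
  qed
qed

lemma finite_distinct_tuples: "finite (distinct_tuples k m)"
  unfolding distinct_tuples_def
  by (rule finite_subset[of _ "{1..k} \<rightarrow>\<^sub>E {1..m}"]) (auto intro: finite_PiE)

lemma distinct_tuples_nonempty:
  assumes "k \<le> m"
  shows "distinct_tuples k m \<noteq> {}"
proof -
  have "restrict id {1..k} \<in> distinct_tuples k m"
    using assms by (auto simp: distinct_tuples_def inj_on_def)
  then show ?thesis by blast
qed

lemma prob_space_gaussian_noise:
  assumes "0 < \<sigma>"
  shows "prob_space (gaussian_noise n \<sigma>)"
  unfolding gaussian_noise_def
  by (intro prob_space_PiM prob_space_normal_density assms)

lemma prob_space_joint_law:
  assumes "k \<le> m" "0 < \<sigma>"
  shows "prob_space (joint_law k n m \<sigma>)"
proof -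
  interpret S: prob_space "uniform_count_measure (distinct_tuples k m)"
    by (intro prob_space_uniform_count_measure finite_distinct_tuples
        distinct_tuples_nonempty assms)
  interpret Z: prob_space "gaussian_noise n \<sigma>"
    by (rule prob_space_gaussian_noise[OF assms(2)])
  interpret P: pair_prob_space
    "uniform_count_measure (distinct_tuples k m)" "gaussian_noise n \<sigma>" ..
  show ?thesis unfolding joint_law_def by (rule P.prob_space_axioms)
qed

lemma sets_gaussian_noise: "sets (gaussian_noise n \<sigma>) = sets (\<Pi>\<^sub>M i\<in>{1..n}. borel)"
  unfolding gaussian_noise_def by (intro sets_PiM_cong) auto

lemma error_event_measurable:
  assumes "support_recovery_map n m d"
  shows "error_event k n m \<sigma> w A d \<in> sets (joint_law k n m \<sigma>)"
proof -
  let ?D = "distinct_tuples k m" and ?G = "gaussian_noise n \<sigma>"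
  let ?B = "\<lambda>S. {Z \<in> space ?G. d (measurement n m A (signal k w S) Z) \<noteq> supp m (signal k w S)}"
  have B: "?B S \<in> sets ?G" for S
  proof -
    have meas: "measurement n m A (signal k w S) \<in> ?G \<rightarrow>\<^sub>M (\<Pi>\<^sub>M i\<in>{1..n}. borel)"
      unfolding measurement_def measurable_cong_sets[OF sets_gaussian_noise refl]
      by (intro measurable_restrict borel_measurable_add) (auto intro: measurable_component_singleton)
    have "(\<lambda>Z. d (measurement n m A (signal k w S) Z)) \<in> ?G \<rightarrow>\<^sub>M count_space (Pow {1..m})"
      using measurable_compose[OF meas assms[unfolded support_recovery_map_def]] .
    then have "(\<lambda>Z. d (measurement n m A (signal k w S) Z)) -` (Pow {1..m} - {supp m (signal k w S)})
                 \<inter> space ?G \<in> sets ?G" (is "?V \<in> _")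
      by (rule measurable_sets) auto
    moreover have "?V = ?B S"
      using measurable_space[OF \<open>_ \<in> ?G \<rightarrow>\<^sub>M count_space (Pow {1..m})\<close>] by auto
    ultimately show ?thesis by simp
  qed
  have "error_event k n m \<sigma> w A d = (\<Union>S\<in>?D. {S} \<times> ?B S)"
    by (auto simp: error_event_def joint_law_def space_pair_measure space_uniform_count_measure)
  also have "\<dots> \<in> sets (joint_law k n m \<sigma>)"
    unfolding joint_law_def
    by (intro sets.finite_UN finite_distinct_tuples pair_measureI B)
      (auto simp: sets_uniform_count_measure)
  finally show ?thesis .
qed

end

theory Submission
  imports Defs "HOL-Real_Asymp.Real_Asymp"
begin

text \<open>
  Fix \<open>T\<close> and reveal \<open>S\<close> outside \<open>T\<close> to the decoder. Compare the law of \<open>Y\<close> given \<open>S\<close> with a Gaussian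
  reference law whose mean depends only on the revealed part and whose variance is
  \<open>\<tau>\<^sup>2 = \<sigma>\<^sub>z\<^sup>2 + \<sigma>\<^sub>a\<^sup>2 (\<Sum>j\<in>T. w\<^sub>j\<^sup>2) m / (m - 1)\<close>. Averaged over \<open>S\<close>, the relative entropy is at most
  \<open>n / 2 * ln (\<tau>\<^sup>2 / \<sigma>\<^sub>z\<^sup>2)\<close>. Under the reference law \<open>Y\<close> carries no information on \<open>S\<close> inside \<open>T\<close>, so
  decoding succeeds with probability at most \<open>(k / (m - k + 1)) ^ card T\<close>. The variational bound
  on relative entropy turns this into
  \<open>(1 - P\<^sub>e) * card T * ln ((m - k + 1) / k) \<le> n / 2 * ln (\<tau>\<^sup>2 / \<sigma>\<^sub>z\<^sup>2) + ln 2\<close>, without entropies of \<open>Y\<close> or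
  Fano's inequality; dividing by \<open>n * card T\<close> and letting \<open>m\<close> grow gives the claim.
\<close>

section \<open>Sampling without replacement\<close>

lemma card_inj_extensions:
  fixes g :: "'a \<Rightarrow> 'b"
  assumes "finite I" "finite M" "card I \<le> card M" "J \<subseteq> I" "g ` J \<subseteq> M" "inj_on g J"
  shows "real (card {S \<in> I \<rightarrow>\<^sub>E M. inj_on S I \<and> (\<forall>j\<in>J. S j = g j)}) =
    fact (card M - card J) / fact (card M - card I)"
  using assms(4-6)
proof (induction "card (I - J)" arbitrary: J g)
  case 0
  then have "J = I"
    using assms(1) by (auto simp: card_eq_0_iff)
  have "{S \<in> I \<rightarrow>\<^sub>E M. inj_on S I \<and> (\<forall>j\<in>I. S j = g j)} = {restrict g I}"
    using 0 \<open>J = I\<close> by (auto simp: PiE_def extensional_def fun_eq_iff inj_on_def)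
  then show ?case by (simp add: \<open>J = I\<close>)
next
  case (Suc c)
  then obtain u where u: "u \<in> I" "u \<notin> J"
    by (metis Diff_iff card.empty ex_in_conv nat.distinct(1))
  have fin: "finite J" using Suc.prems assms(1) finite_subset by blast
  let ?X = "\<lambda>J g. {S \<in> I \<rightarrow>\<^sub>E M. inj_on S I \<and> (\<forall>j\<in>J. S j = g j)}"
  have finX: "finite (?X J g)" for J g
    by (rule finite_subset[of _ "I \<rightarrow>\<^sub>E M"]) (auto intro: finite_PiE assms)
  have cJ: "card J < card I"
    using u Suc.prems assms(1) by (intro psubset_card_mono) auto
  have "?X J g = (\<Union>s\<in>M - g ` J. ?X (insert u J) (g(u := s)))"
  proof (intro equalityI subsetI)
    fix S assume S: "S \<in> ?X J g"
    have "S u \<notin> g ` J"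
    proof
      assume "S u \<in> g ` J"
      then obtain j where "j \<in> J" "S u = S j" using S by auto
      moreover have "j \<in> I" using \<open>j \<in> J\<close> Suc.prems(1) by blast
      ultimately have "u = j" using S u(1) \<open>S u = S j\<close> inj_onD[of S I u j] by blast
      then show False using u \<open>j \<in> J\<close> by blast
    qed
    moreover have "S u \<in> M" using S u by auto
    ultimately show "S \<in> (\<Union>s\<in>M - g ` J. ?X (insert u J) (g(u := s)))"
      using S u by (intro UN_I[of "S u"]) auto
  next
    fix S assume "S \<in> (\<Union>s\<in>M - g ` J. ?X (insert u J) (g(u := s)))"
    then obtain s where "S \<in> ?X (insert u J) (g(u := s))" by blast
    then show "S \<in> ?X J g" using u by (simp add: fun_upd_def)
  qed
  then have "card (?X J g) = card (\<Union>s\<in>M - g ` J. ?X (insert u J) (g(u := s)))"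
    by (rule arg_cong)
  also have "\<dots> = (\<Sum>s\<in>M - g ` J. card (?X (insert u J) (g(u := s))))"
  proof (rule card_UN_disjoint)
    show "\<forall>s\<in>M - g ` J. \<forall>s'\<in>M - g ` J. s \<noteq> s' \<longrightarrow>
        ?X (insert u J) (g(u := s)) \<inter> ?X (insert u J) (g(u := s')) = {}"
    proof (intro ballI impI)
      fix s s' :: 'b assume "s \<noteq> s'"
      moreover have "S u = s" if "S \<in> ?X (insert u J) (g(u := s))" for S and s :: 'b
        using that by simp
      ultimately show "?X (insert u J) (g(u := s)) \<inter> ?X (insert u J) (g(u := s')) = {}"
        by blast
    qed
    show "finite (M - g ` J)" using assms(2) by simp
    show "\<forall>s\<in>M - g ` J. finite (?X (insert u J) (g(u := s)))"
      using finX by (rule ballI)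
  qed
  also have "real \<dots> = (\<Sum>s\<in>M - g ` J. fact (card M - card (insert u J)) / fact (card M - card I))"
    unfolding of_nat_sum
  proof (intro sum.cong refl Suc.hyps)
    show "c = card (I - insert u J)"
    proof -
      have "I - insert u J = (I - J) - {u}" by blast
      then have "card (I - insert u J) = card (I - J) - 1"
        using u card_Diff_singleton[of u "I - J"] by simp
      then show ?thesis using Suc.hyps(2) by simp
    qed
  next
    fix s assume s: "s \<in> M - g ` J"
    show "inj_on (g(u := s)) (insert u J)"
      using s u Suc.prems by (auto simp: inj_on_def)
  qed (use u Suc.prems in auto)
  also have "\<dots> = real (card M - card J) * fact (card M - Suc (card J)) / fact (card M - card I)"
    using u fin Suc.prems assms by (simp add: card_Diff_subset card_image)
  also have "\<dots> = fact (card M - card J) / fact (card M - card I)"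
  proof -
    have "fact (card M - card J) = real (card M - card J) * fact (card M - card J - 1)"
      using cJ assms(3) by (intro fact_reduce) simp
    then show ?thesis by simp
  qed
  finally show ?case .
qed

lemma card_distinct_tuples_extending:
  assumes "k \<le> m" "J \<subseteq> {1..k}" "g ` J \<subseteq> {1..m}" "inj_on g J"
  shows "real (card {S \<in> distinct_tuples k m. \<forall>j\<in>J. S j = g j}) =
    fact (m - card J) / fact (m - k)"
proof -
  have "{S \<in> distinct_tuples k m. \<forall>j\<in>J. S j = g j} =
    {S \<in> {1..k} \<rightarrow>\<^sub>E {1..m}. inj_on S {1..k} \<and> (\<forall>j\<in>J. S j = g j)}"
    by (auto simp: distinct_tuples_def)
  then show ?thesis
    using card_inj_extensions[of "{1..k}" "{1..m}" J g] assms by simp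
qed

lemma card_distinct_tuples:
  assumes "k \<le> m"
  shows "real (card (distinct_tuples k m)) = fact m / fact (m - k)"
  using card_distinct_tuples_extending[of k m "{}"] assms by simp

lemma distinct_tuples_in: "S \<in> distinct_tuples k m \<Longrightarrow> j \<in> {1..k} \<Longrightarrow> S j \<in> {1..m}"
  by (auto simp: distinct_tuples_def)

text \<open>The classes with \<open>S j = s\<close> are equally large for all \<open>s\<close>, so a
  single coordinate is uniformly distributed.\<close>

lemma sum_distinct_tuples_one:
  fixes h :: "nat \<Rightarrow> real"
  assumes "k \<le> m" "j \<in> {1..k}"
  shows "(\<Sum>S\<in>distinct_tuples k m. h (S j)) =
    real (card (distinct_tuples k m)) / real m * (\<Sum>s\<in>{1..m}. h s)"
proof -
  let ?D = "distinct_tuples k m"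
  have m: "m \<ge> 1" using assms by auto
  have fm: "fact m = real m * fact (m - 1)"
    using m by (simp add: fact_reduce)
  have cnt: "real (card {S \<in> ?D. S j = s}) = real (card ?D) / real m" if "s \<in> {1..m}" for s
    using card_distinct_tuples_extending[of k m "{j}" "\<lambda>_. s"] card_distinct_tuples[of k m]
      assms that m by (simp add: fm)
  have "(\<Sum>S\<in>?D. h (S j)) = (\<Sum>s\<in>{1..m}. \<Sum>S\<in>{S \<in> ?D. S j = s}. h (S j))"
    by (rule sum.group[symmetric]) (use assms distinct_tuples_in finite_distinct_tuples in auto)
  also have "\<dots> = (\<Sum>s\<in>{1..m}. real (card {S \<in> ?D. S j = s}) * h s)"
    by (intro sum.cong refl) simp
  also have "\<dots> = (\<Sum>s\<in>{1..m}. real (card ?D) / real m * h s)"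
    by (intro sum.cong refl) (simp only: cnt)
  finally show ?thesis by (simp add: sum_distrib_left)
qed

text \<open>Grouping by the pair of values works because all \<open>m * (m - 1)\<close> ordered
  pairs of distinct values have equally large classes. This supplies the covariances of the entries
  picked by the tuple.\<close>

lemma sum_distinct_tuples_two:
  fixes h :: "nat \<Rightarrow> nat \<Rightarrow> real"
  assumes "k \<le> m" "j \<in> {1..k}" "l \<in> {1..k}" "j \<noteq> l"
  shows "(\<Sum>S\<in>distinct_tuples k m. h (S j) (S l)) =
    real (card (distinct_tuples k m)) / (real m * (real m - 1)) *
      (\<Sum>s\<in>{1..m}. \<Sum>s'\<in>{1..m} - {s}. h s s')"
proof -
  let ?D = "distinct_tuples k m" and ?P = "SIGMA s:{1..m}. {1..m} - {s}"
  have m: "m \<ge> 2" using assms by auto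
  have fm: "fact m = real m * (real m - 1) * fact (m - 2)"
  proof -
    obtain m' where "m = Suc (Suc m')" using m by (metis Suc_1 Suc_le_D add_2_eq_Suc le_Suc_ex)
    then show ?thesis by simp
  qed
  have cnt: "real (card {S \<in> ?D. (S j, S l) = p}) = real (card ?D) / (real m * (real m - 1))"
    if "p \<in> ?P" for p
  proof -
    have "{S \<in> ?D. (S j, S l) = p} = {S \<in> ?D. \<forall>i\<in>{j, l}. S i = (if i = j then fst p else snd p)}"
      using assms by auto
    moreover have "real (card {S \<in> ?D. \<forall>i\<in>{j, l}. S i = (if i = j then fst p else snd p)}) =
        fact (m - card {j, l}) / fact (m - k)"
      by (rule card_distinct_tuples_extending) (use assms that in \<open>auto simp: inj_on_def\<close>)
    ultimately show ?thesis
      using card_distinct_tuples[of k m] assms(1,4) m by (simp add: fm numeral_2_eq_2)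
  qed
  have "(\<Sum>S\<in>?D. h (S j) (S l)) =
      (\<Sum>p\<in>?P. \<Sum>S\<in>{S \<in> ?D. (S j, S l) = p}. h (S j) (S l))"
  proof (rule sum.group[symmetric])
    show "(\<lambda>S. (S j, S l)) ` ?D \<subseteq> ?P"
    proof (rule image_subsetI)
      fix S assume "S \<in> ?D"
      then have "S j \<in> {1..m}" "S l \<in> {1..m}" "S j \<noteq> S l"
        using assms inj_onD[of S "{1..k}" j l] by (auto simp: distinct_tuples_def)
      then show "(S j, S l) \<in> ?P" by simp
    qed
  qed (auto simp: finite_distinct_tuples)
  also have "\<dots> = (\<Sum>p\<in>?P. real (card {S \<in> ?D. (S j, S l) = p}) * h (fst p) (snd p))"
  proof (intro sum.cong refl)
    fix p
    have "(\<Sum>S\<in>{S \<in> ?D. (S j, S l) = p}. h (S j) (S l)) = (\<Sum>S\<in>{S \<in> ?D. (S j, S l) = p}. h (fst p) (snd p))"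
      by (rule sum.cong) auto
    then show "(\<Sum>S\<in>{S \<in> ?D. (S j, S l) = p}. h (S j) (S l)) =
        real (card {S \<in> ?D. (S j, S l) = p}) * h (fst p) (snd p)"
      by simp
  qed
  also have "\<dots> = (\<Sum>p\<in>?P. real (card ?D) / (real m * (real m - 1)) * h (fst p) (snd p))"
    by (intro sum.cong refl) (simp only: cnt)
  also have "\<dots> = real (card ?D) / (real m * (real m - 1)) * (\<Sum>(s, s')\<in>?P. h s s')"
    by (simp add: sum_distrib_left case_prod_beta)
  finally show ?thesis by (simp add: sum.Sigma)
qed

text \<open>Two coordinates of a tuple drawn without replacement are negatively correlated, which costs
  only the factor \<open>m / (m - 1)\<close> compared to independent coordinates.\<close>

lemma sum_distinct_tuples_square_le:
  fixes w c :: "nat \<Rightarrow> real"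
  assumes "k \<le> m" "T \<subseteq> {1..k}" "2 \<le> m" "(\<Sum>s\<in>{1..m}. c s) = 0"
  shows "(\<Sum>S\<in>distinct_tuples k m. (\<Sum>j\<in>T. w j * c (S j))\<^sup>2) \<le>
    real (card (distinct_tuples k m)) / (real m - 1) * (\<Sum>j\<in>T. (w j)\<^sup>2) * (\<Sum>s\<in>{1..m}. (c s)\<^sup>2)"
proof -
  let ?D = "distinct_tuples k m"
  define N where "N = real (card ?D)"
  define V where "V = (\<Sum>s\<in>{1..m}. (c s)\<^sup>2)"
  define F where "F = (\<lambda>j l. \<Sum>S\<in>?D. c (S j) * c (S l))"
  have fin: "finite T" using assms finite_subset by blast
  have F1: "F j j = N / real m * V" if "j \<in> T" for j
    using sum_distinct_tuples_one[of k m j "\<lambda>s. c s * c s"] assms that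
    by (auto simp: F_def N_def V_def power2_eq_square)
  \<comment> \<open>As \<open>c\<close> sums to zero, the terms other than \<open>c s\<close> sum to
    \<open>- c s\<close>; hence the covariance of two distinct coordinates is nonpositive.\<close>
  have F2: "F j l = - (N / (real m * (real m - 1)) * V)" if "j \<in> T" "l \<in> T" "j \<noteq> l" for j l
  proof -
    have "(\<Sum>s'\<in>{1..m} - {s}. c s * c s') = - (c s)\<^sup>2" if "s \<in> {1..m}" for s
    proof -
      have "c s + (\<Sum>s'\<in>{1..m} - {s}. c s') = 0"
        using assms(4) sum.remove[of "{1..m}" s c] that by simp
      then have "(\<Sum>s'\<in>{1..m} - {s}. c s') = - c s" by simp
      then show ?thesis by (simp add: sum_distrib_left[symmetric] power2_eq_square)
    qed
    then have "(\<Sum>s\<in>{1..m}. \<Sum>s'\<in>{1..m} - {s}. c s * c s') = - V"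
      by (simp add: V_def sum_negf)
    then show ?thesis
      using sum_distinct_tuples_two[of k m j l "\<lambda>s s'. c s * c s'"] assms(1,2) that
      by (simp add: F_def N_def subset_eq)
  qed
  have "(\<Sum>S\<in>?D. (\<Sum>j\<in>T. w j * c (S j))\<^sup>2) = (\<Sum>S\<in>?D. \<Sum>j\<in>T. \<Sum>l\<in>T. w j * w l * (c (S j) * c (S l)))"
    by (simp add: power2_eq_square sum_product algebra_simps)
  also have "\<dots> = (\<Sum>j\<in>T. \<Sum>l\<in>T. w j * w l * F j l)"
    unfolding F_def sum_distrib_left
    by (subst sum.swap, intro sum.cong refl, subst sum.swap, rule refl)
  also have "\<dots> = (\<Sum>j\<in>T. \<Sum>l\<in>T. (if l = j then N / (real m - 1) * V * (w j)\<^sup>2 else 0)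
      - N / (real m * (real m - 1)) * V * (w j * w l))"
  proof (intro sum.cong refl)
    fix j l assume "j \<in> T" "l \<in> T"
    \<comment> \<open>Writes the diagonal entry as the off-diagonal one plus a rest, so that
      \<open>F\<close> becomes a multiple of the identity minus a constant matrix.\<close>
    moreover have "N / real m * V = N / (real m - 1) * V - N / (real m * (real m - 1)) * V"
      using assms(3) by (simp add: divide_simps) (simp add: algebra_simps)
    ultimately have "F j l = (if l = j then N / (real m - 1) * V else 0) - N / (real m * (real m - 1)) * V"
      using F1[of j] F2[of j l] by (cases "l = j") simp_all
    then show "w j * w l * F j l = (if l = j then N / (real m - 1) * V * (w j)\<^sup>2 else 0)
      - N / (real m * (real m - 1)) * V * (w j * w l)"
      by (simp only:) (simp add: left_diff_distrib right_diff_distrib mult.commute power2_eq_square)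
  qed
  also have "\<dots> = N / (real m - 1) * V * (\<Sum>j\<in>T. (w j)\<^sup>2)
      - N / (real m * (real m - 1)) * V * (\<Sum>j\<in>T. w j)\<^sup>2"
  proof -
    have "(\<Sum>j\<in>T. \<Sum>l\<in>T. x * (w j * w l)) = x * (\<Sum>j\<in>T. w j)\<^sup>2" for x
      unfolding power2_eq_square sum_product by (simp add: sum_distrib_left)
    then show ?thesis
      unfolding sum_subtractf using fin by (simp add: sum_distrib_left del: times_divide_eq_left)
  qed
  \<comment> \<open>The discarded term is a nonnegative multiple of the square of the weight
    sum.\<close>
  also have "\<dots> \<le> N / (real m - 1) * V * (\<Sum>j\<in>T. (w j)\<^sup>2)"
    using assms(3) by (simp add: N_def V_def sum_nonneg)
  finally show ?thesis by (simp add: N_def V_def mult_ac)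
qed

section \<open>Decoding under laws that see only the revealed part\<close>

lemma fact_add_ge: "(real a + 1) ^ t * fact a \<le> fact (a + t)"
proof (induction t)
  case (Suc t)
  have "(real a + 1) * ((real a + 1) ^ t * fact a) \<le> (real (a + t) + 1) * fact (a + t)"
    using Suc by (intro mult_mono) auto
  then show ?case by (simp add: algebra_simps)
qed simp

text \<open>Given the tuple outside \<open>T\<close>, an observation names at most \<open>k ^ card T\<close> of the at least
  \<open>(m - k + 1) ^ card T\<close> possible tuples.\<close>

lemma sum_correct_reference_le:
  assumes "k \<le> m" "T \<subseteq> {1..k}"
    and Q: "\<And>S. S \<in> distinct_tuples k m \<Longrightarrow> prob_space (Q (restrict S ({1..k} - T)))"
    and meas: "\<And>S B. S \<in> distinct_tuples k m \<Longrightarrow>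
      {y \<in> space (Q (restrict S ({1..k} - T))). d y = B} \<in> sets (Q (restrict S ({1..k} - T)))"
  shows "(\<Sum>S\<in>distinct_tuples k m. measure (Q (restrict S ({1..k} - T)))
      {y \<in> space (Q (restrict S ({1..k} - T))). d y = S ` {1..k}}) * (real (m - k) + 1) ^ card T \<le>
    real (card (distinct_tuples k m)) * real k ^ card T"
proof -
  let ?D = "distinct_tuples k m"
  \<comment> \<open>\<open>r S\<close> is what is revealed, a fibre \<open>fib S0\<close> collects
    the tuples still possible after \<open>S0\<close> is revealed, and \<open>q S\<close> is the
    probability of naming the support under the reference law.\<close>
  define r where "r = (\<lambda>S::nat \<Rightarrow> nat. restrict S ({1..k} - T))"
  define fib where "fib = (\<lambda>S0. {S \<in> ?D. r S = S0})"
  define q where "q = (\<lambda>S. measure (Q (r S)) {y \<in> space (Q (r S)). d y = S ` {1..k}})"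
  define c where "c = fact (m - card ({1..k} - T)) / (fact (m - k) :: real)"
  have fin: "finite T" "finite ?D" using assms finite_subset finite_distinct_tuples by blast+
  have finfib: "finite (fib S0)" for S0 using fin by (simp add: fib_def)
  have cT: "card ({1..k} - T) = k - card T" "card T \<le> k"
    using assms fin card_mono[of "{1..k}" T] by (auto simp: card_Diff_subset)
  \<comment> \<open>\<open>c\<close>, the common size of the fibres, is a product of
    \<open>card T\<close> consecutive integers starting at \<open>m - k + 1\<close>.\<close>
  have c: "(real (m - k) + 1) ^ card T \<le> c"
    using fact_add_ge[of "m - k" "card T"] cT assms(1)
    by (simp add: c_def field_simps)
  have cardfib: "real (card (fib S0)) = c" if "S0 \<in> r ` ?D" for S0
  proof -
    obtain S' where S': "S' \<in> ?D" "S0 = r S'" using \<open>S0 \<in> r ` ?D\<close> by blast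
    have "r S = r S' \<longleftrightarrow> (\<forall>j\<in>{1..k} - T. S j = S' j)" for S
      unfolding r_def by (metis restrict_apply' restrict_ext)
    then have "fib S0 = {S \<in> ?D. \<forall>j\<in>{1..k} - T. S j = S' j}"
      unfolding fib_def S'(2) by simp
    moreover have "inj_on S' ({1..k} - T)" "S' ` ({1..k} - T) \<subseteq> {1..m}"
      using S'(1) inj_on_subset[of S' "{1..k}"] by (auto simp: distinct_tuples_def)
    ultimately show ?thesis
      using card_distinct_tuples_extending[of k m "{1..k} - T" S'] assms(1)
      unfolding c_def by simp
  qed
  have count: "card {S \<in> fib S0. S ` {1..k} = B} \<le> k ^ card T" for S0 B
  proof (cases "{S \<in> fib S0. S ` {1..k} = B} = {}")
    case False
    then obtain S' where "S' \<in> ?D" "S' ` {1..k} = B" by (auto simp: fib_def)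
    then have "card B = k" "finite B" using card_image[of S' "{1..k}"]
      by (auto simp: distinct_tuples_def)
    \<comment> \<open>Within a fibre a tuple is determined by its values on \<open>T\<close>; when
      its range is \<open>B\<close>, these values lie in the \<open>k\<close>-element set
      \<open>B\<close>.\<close>
    have "card {S \<in> fib S0. S ` {1..k} = B} \<le> card (T \<rightarrow>\<^sub>E B)"
    proof (rule card_inj_on_le)
      show "inj_on (\<lambda>S. restrict S T) {S \<in> fib S0. S ` {1..k} = B}"
      proof (rule inj_onI)
        fix S S' assume S: "S \<in> {S \<in> fib S0. S ` {1..k} = B}" "S' \<in> {S \<in> fib S0. S ` {1..k} = B}"
          and eq: "restrict S T = restrict S' T"
        have eq': "restrict S ({1..k} - T) = restrict S' ({1..k} - T)"
          using S by (auto simp: fib_def r_def)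
        have "S j = S' j" for j
        proof -
          consider "j \<in> T" | "j \<in> {1..k} - T" | "j \<notin> {1..k}" by blast
          then show ?thesis
          proof cases
            case 1 then show ?thesis using eq by (metis restrict_apply')
          next
            case 2 then show ?thesis using eq' by (metis restrict_apply')
          next
            case 3 then show ?thesis using S
              by (auto simp: fib_def distinct_tuples_def PiE_def extensional_def)
          qed
        qed
        then show "S = S'" by blast
      qed
      show "(\<lambda>S. restrict S T) ` {S \<in> fib S0. S ` {1..k} = B} \<subseteq> T \<rightarrow>\<^sub>E B"
        using assms(2) by auto
      show "finite (T \<rightarrow>\<^sub>E B)" using fin \<open>finite B\<close> by (auto intro: finite_PiE)
    qed
    then show ?thesis using \<open>card B = k\<close> fin by (simp add: card_PiE)
  qed (simp only: card.empty le0)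
  have inner: "(\<Sum>S\<in>fib S0. q S) \<le> real k ^ card T" if "S0 \<in> r ` ?D" for S0
  proof -
    obtain S' where S': "S' \<in> ?D" "S0 = r S'" using \<open>S0 \<in> r ` ?D\<close> by blast
    interpret Q: prob_space "Q S0" using Q[OF S'(1)] S'(2) by (simp add: r_def)
    let ?E = "\<lambda>S::nat \<Rightarrow> nat. {y \<in> space (Q S0). d y = S ` {1..k}}"
    have E: "?E S \<in> sets (Q S0)" for S
      using meas[OF S'(1)] S'(2) by (simp add: r_def)
    have int: "integrable (Q S0) (indicator (?E S) :: _ \<Rightarrow> real)" for S
      by (intro integrable_real_indicator E) (simp add: Q.emeasure_eq_measure)
    \<comment> \<open>All tuples of the fibre share the law \<open>Q S0\<close>, so the
      probabilities add up to one integral; at each \<open>y\<close> at most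
      \<open>k ^ card T\<close> of the indicators equal 1.\<close>
    have "(\<Sum>S\<in>fib S0. q S) = (\<Sum>S\<in>fib S0. \<integral>y. indicator (?E S) y \<partial>Q S0)"
    proof (intro sum.cong refl)
      fix S assume "S \<in> fib S0"
      then have "q S = measure (Q S0) (?E S)" by (simp add: q_def fib_def)
      then show "q S = (\<integral>y. indicator (?E S) y \<partial>Q S0)"
        using sets.Int_space_eq2[OF E[of S]] by (simp only: Bochner_Integration.integral_indicator)
    qed
    also have "\<dots> = (\<integral>y. (\<Sum>S\<in>fib S0. indicator (?E S) y) \<partial>Q S0)"
      by (rule Bochner_Integration.integral_sum[symmetric]) (rule int)
    also have "\<dots> \<le> (\<integral>y. real k ^ card T \<partial>Q S0)"
    proof (intro integral_mono)
      fix y assume y: "y \<in> space (Q S0)"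
      have "(\<Sum>S\<in>fib S0. indicator (?E S) y :: real) = real (card {S \<in> fib S0. S ` {1..k} = d y})"
      proof -
        have "(\<Sum>S\<in>fib S0. indicator (?E S) y :: real) = (\<Sum>S\<in>fib S0. if S ` {1..k} = d y then 1 else 0)"
          using y by (intro sum.cong refl) (auto simp: indicator_def)
        also have "\<dots> = (\<Sum>S\<in>{S \<in> fib S0. S ` {1..k} = d y}. 1)"
          by (rule sum.inter_filter[OF finfib, symmetric])
        finally show ?thesis by simp
      qed
      also have "\<dots> \<le> real (k ^ card T)" using count by (intro of_nat_mono)
      finally show "(\<Sum>S\<in>fib S0. indicator (?E S) y :: real) \<le> real k ^ card T" by simp
    next
      show "integrable (Q S0) (\<lambda>y. \<Sum>S\<in>fib S0. indicator (?E S) y :: real)"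
        by (rule Bochner_Integration.integrable_sum) (rule int)
    qed simp
    finally show ?thesis by (simp add: Q.prob_space)
  qed
  have group: "(\<Sum>S\<in>?D. f S) = (\<Sum>S0\<in>r ` ?D. \<Sum>S\<in>fib S0. f S)" for f :: "_ \<Rightarrow> real"
    using sum.image_gen[OF fin(2), of f r] by (simp only: fib_def)
  have "(\<Sum>S\<in>?D. q S) \<le> (\<Sum>S0\<in>r ` ?D. real k ^ card T)"
    unfolding group[of q] by (intro sum_mono inner)
  \<comment> \<open>The number of fibres is eliminated: multiplied by \<open>c\<close> it is the
    number of all tuples.\<close>
  then have "(\<Sum>S\<in>?D. q S) * (real (m - k) + 1) ^ card T \<le> (\<Sum>S0\<in>r ` ?D. real k ^ card T) * c"
    by (rule mult_mono[OF _ c]) simp_all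
  also have "\<dots> = (\<Sum>S0\<in>r ` ?D. c) * real k ^ card T"
    by simp
  also have "(\<Sum>S0\<in>r ` ?D. c) = (\<Sum>S0\<in>r ` ?D. \<Sum>S\<in>fib S0. 1)"
    by (intro sum.cong refl) (simp add: cardfib)
  also have "\<dots> = real (card ?D)"
    using group[of "\<lambda>_. 1"] by simp
  finally show ?thesis unfolding q_def r_def .
qed

section \<open>Gaussian change of measure\<close>

definition gaussian :: "real \<Rightarrow> real \<Rightarrow> real measure" where
  "gaussian \<mu> \<sigma> = density lborel (\<lambda>x. ennreal (normal_density \<mu> \<sigma> x))"

lemma sets_gaussian [simp, measurable_cong]: "sets (gaussian \<mu> \<sigma>) = sets borel"
  and space_gaussian [simp]: "space (gaussian \<mu> \<sigma>) = UNIV"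
  by (simp_all add: gaussian_def)

lemma prob_space_gaussian: "0 < \<sigma> \<Longrightarrow> prob_space (gaussian \<mu> \<sigma>)"
  unfolding gaussian_def by (rule prob_space_normal_density)

lemma gaussian_noise_altdef: "gaussian_noise n \<sigma> = (\<Pi>\<^sub>M i\<in>{1..n}. gaussian 0 \<sigma>)"
  by (simp add: gaussian_noise_def gaussian_def)

text \<open>The density in the denominator never vanishes, so it cancels. This is the one-coordinate
  change of measure.\<close>

lemma density_gaussian_ratio:
  assumes "0 < \<sigma>"
  shows "density (gaussian \<mu> \<sigma>) (\<lambda>x. ennreal (normal_density \<nu> \<tau> x / normal_density \<mu> \<sigma> x)) = gaussian \<nu> \<tau>"
  unfolding gaussian_def
proof (subst density_density_eq)
  show "density lborel (\<lambda>x. ennreal (normal_density \<mu> \<sigma> x) * ennreal (normal_density \<nu> \<tau> x / normal_density \<mu> \<sigma> x))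
    = density lborel (\<lambda>x. ennreal (normal_density \<nu> \<tau> x))"
    using normal_density_pos[OF assms, of \<mu>]
    by (intro density_cong) (auto simp: ennreal_mult[symmetric] less_imp_le less_imp_neq[symmetric])
qed auto

text \<open>Translation invariance of Lebesgue measure, applied to the density; it carries a law of
  the noise to a law of the observation.\<close>

lemma distr_gaussian_shift:
  "distr (gaussian \<nu> \<tau>) borel ((+) x) = gaussian (x + \<nu>) \<tau>"
proof (rule measure_eqI)
  fix A :: "real set" assume "A \<in> sets (distr (gaussian \<nu> \<tau>) borel ((+) x))"
  then have [measurable]: "A \<in> sets borel" by simp
  have "emeasure (gaussian (x + \<nu>) \<tau>) A = (\<integral>\<^sup>+y. ennreal (normal_density (x + \<nu>) \<tau> y) * indicator A y \<partial>lborel)"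
    by (simp add: gaussian_def emeasure_density)
  also have "\<dots> = (\<integral>\<^sup>+y. ennreal (normal_density (x + \<nu>) \<tau> (x + 1 * y)) * indicator A (x + 1 * y) \<partial>lborel)"
    by (subst nn_integral_real_affine[where c=1 and t=x]) (auto)
  also have "\<dots> = (\<integral>\<^sup>+y. ennreal (normal_density \<nu> \<tau> y) * indicator ((+) x -` A) y \<partial>lborel)"
    by (intro nn_integral_cong) (auto simp: normal_density_def indicator_def)
  also have "\<dots> = emeasure (gaussian \<nu> \<tau>) ((+) x -` A)"
    using measurable_sets[of "(+) x" borel borel A] by (simp add: gaussian_def emeasure_density)
  also have "\<dots> = emeasure (distr (gaussian \<nu> \<tau>) borel ((+) x)) A"
    by (subst emeasure_distr) (auto simp: gaussian_def)
  finally show "emeasure (distr (gaussian \<nu> \<tau>) borel ((+) x)) A = emeasure (gaussian (x + \<nu>) \<tau>) A"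
    by simp
qed simp

text \<open>A product measure is determined by its values on boxes, and there Fubini factors the
  integral.\<close>

lemma density_PiM:
  assumes "finite I" "\<And>i. prob_space (M i)" "\<And>i. prob_space (density (M i) (f i))"
    and f: "\<And>i. f i \<in> borel_measurable (M i)"
  shows "density (\<Pi>\<^sub>M i\<in>I. M i) (\<lambda>z. \<Prod>i\<in>I. f i (z i)) = (\<Pi>\<^sub>M i\<in>I. density (M i) (f i))"
proof -
  note [measurable] = f
  interpret M: product_prob_space M I by (intro product_prob_spaceI assms)
  interpret N: product_prob_space "\<lambda>i. density (M i) (f i)" I by (intro product_prob_spaceI assms)
  show ?thesis
  proof (rule N.PiM_eqI)
    show "sets (density (\<Pi>\<^sub>M i\<in>I. M i) (\<lambda>z. \<Prod>i\<in>I. f i (z i))) = sets (\<Pi>\<^sub>M i\<in>I. density (M i) (f i))"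
      by (simp cong: sets_PiM_cong)
  next
    fix A assume "\<And>i. i \<in> I \<Longrightarrow> A i \<in> sets (density (M i) (f i))"
    then have A: "\<And>i. i \<in> I \<Longrightarrow> A i \<in> sets (M i)" by simp
    have "emeasure (density (\<Pi>\<^sub>M i\<in>I. M i) (\<lambda>z. \<Prod>i\<in>I. f i (z i))) (Pi\<^sub>E I A)
        = (\<integral>\<^sup>+z. (\<Prod>i\<in>I. f i (z i)) * indicator (Pi\<^sub>E I A) z \<partial>(\<Pi>\<^sub>M i\<in>I. M i))"
      by (rule emeasure_density) (auto intro!: sets_PiM_I_finite assms A)
    also have "\<dots> = (\<integral>\<^sup>+z. (\<Prod>i\<in>I. f i (z i) * indicator (A i) (z i)) \<partial>(\<Pi>\<^sub>M i\<in>I. M i))"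
    proof (rule nn_integral_cong)
      fix z assume "z \<in> space (\<Pi>\<^sub>M i\<in>I. M i)"
      \<comment> \<open>Points of the product space are extensional, so membership in the box is a
        condition on each coordinate separately.\<close>
      then have "z \<in> extensional I" by (auto simp: space_PiM PiE_def)
      then have "indicator (Pi\<^sub>E I A) z = (\<Prod>i\<in>I. indicator (A i) (z i) :: ennreal)"
        using assms(1) by (cases "z \<in> Pi I A") (auto simp: indicator_def PiE_def Pi_iff intro!: prod_zero)
      then show "(\<Prod>i\<in>I. f i (z i)) * indicator (Pi\<^sub>E I A) z = (\<Prod>i\<in>I. f i (z i) * indicator (A i) (z i))"
        by (simp add: prod.distrib)
    qed
    also have "\<dots> = (\<Prod>i\<in>I. \<integral>\<^sup>+x. f i x * indicator (A i) x \<partial>M i)"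
      using A by (intro M.product_nn_integral_prod assms) auto
    also have "\<dots> = (\<Prod>i\<in>I. emeasure (density (M i) (f i)) (A i))"
      using A by (intro prod.cong refl) (simp add: emeasure_density)
    finally show "emeasure (density (\<Pi>\<^sub>M i\<in>I. M i) (\<lambda>z. \<Prod>i\<in>I. f i (z i))) (Pi\<^sub>E I A)
      = (\<Prod>i\<in>I. emeasure (density (M i) (f i)) (A i))" .
  qed fact
qed

text \<open>Checked on boxes: the preimage of a box under a coordinatewise map is the box of the
  preimages.\<close>

lemma distr_PiM_componentwise:
  assumes "finite I" "\<And>i. prob_space (M i)" 
    and f: "\<And>i. f i \<in> M i \<rightarrow>\<^sub>M N i"
  shows "distr (\<Pi>\<^sub>M i\<in>I. M i) (\<Pi>\<^sub>M i\<in>I. N i) (\<lambda>z. \<lambda>i\<in>I. f i (z i)) = (\<Pi>\<^sub>M i\<in>I. distr (M i) (N i) (f i))"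
proof -
  note [measurable] = f
  interpret M: product_prob_space M I by (intro product_prob_spaceI assms)
  interpret D: product_prob_space "\<lambda>i. distr (M i) (N i) (f i)" I
    by (intro product_prob_spaceI prob_space.prob_space_distr assms)
  have F[measurable]: "(\<lambda>z. \<lambda>i\<in>I. f i (z i)) \<in> (\<Pi>\<^sub>M i\<in>I. M i) \<rightarrow>\<^sub>M (\<Pi>\<^sub>M i\<in>I. N i)"
    by measurable
  show ?thesis
  proof (rule D.PiM_eqI)
    show "sets (distr (\<Pi>\<^sub>M i\<in>I. M i) (\<Pi>\<^sub>M i\<in>I. N i) (\<lambda>z. \<lambda>i\<in>I. f i (z i))) = sets (\<Pi>\<^sub>M i\<in>I. distr (M i) (N i) (f i))"
      by (simp cong: sets_PiM_cong)
  next
    fix A assume "\<And>i. i \<in> I \<Longrightarrow> A i \<in> sets (distr (M i) (N i) (f i))"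
    then have A: "\<And>i. i \<in> I \<Longrightarrow> A i \<in> sets (N i)" by simp
    have "(\<lambda>z. \<lambda>i\<in>I. f i (z i)) -` Pi\<^sub>E I A \<inter> space (\<Pi>\<^sub>M i\<in>I. M i)
        = (\<Pi>\<^sub>E i\<in>I. f i -` A i \<inter> space (M i))"
      by (auto simp: space_PiM PiE_iff)
    then show "emeasure (distr (\<Pi>\<^sub>M i\<in>I. M i) (\<Pi>\<^sub>M i\<in>I. N i) (\<lambda>z. \<lambda>i\<in>I. f i (z i))) (Pi\<^sub>E I A)
      = (\<Prod>i\<in>I. emeasure (distr (M i) (N i) (f i)) (A i))"
      using A assms(1) by (simp add: emeasure_distr sets_PiM_I_finite M.emeasure_PiM measurable_sets[OF f])
  qed fact
qed

lemma gaussian_noise_change_of_measure: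
  assumes "0 < \<sigma>" "0 < \<tau>"
  shows "density (gaussian_noise n \<sigma>)
      (\<lambda>z. ennreal (\<Prod>i\<in>{1..n}. normal_density (\<nu> i) \<tau> (z i) / normal_density 0 \<sigma> (z i)))
    = (\<Pi>\<^sub>M i\<in>{1..n}. gaussian (\<nu> i) \<tau>)"
proof -
  have "density (\<Pi>\<^sub>M i\<in>{1..n}. gaussian 0 \<sigma>)
      (\<lambda>z. \<Prod>i\<in>{1..n}. ennreal (normal_density (\<nu> i) \<tau> (z i) / normal_density 0 \<sigma> (z i)))
    = (\<Pi>\<^sub>M i\<in>{1..n}. density (gaussian 0 \<sigma>)
        (\<lambda>x. ennreal (normal_density (\<nu> i) \<tau> x / normal_density 0 \<sigma> x)))"
    by (rule density_PiM) (auto simp: density_gaussian_ratio assms intro!: prob_space_gaussian)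
  then show ?thesis
    using assms
    by (simp add: gaussian_noise_altdef density_gaussian_ratio prod_ennreal)
qed

text \<open>With \<open>x\<close> the noiseless measurement, this turns a tilted noise law into a
  law of the observation; when the noise means are \<open>c i - x i\<close>, the resulting law no
  longer depends on \<open>x\<close>.\<close>

lemma distr_gaussian_PiM_shift:
  fixes n :: nat
  assumes "0 < \<tau>"
  shows "distr (\<Pi>\<^sub>M i\<in>{1..n}. gaussian (\<nu> i) \<tau>) (\<Pi>\<^sub>M i\<in>{1..n}. borel) (\<lambda>z. \<lambda>i\<in>{1..n}. x i + z i)
    = (\<Pi>\<^sub>M i\<in>{1..n}. gaussian (x i + \<nu> i) \<tau>)"
proof -
  have "distr (\<Pi>\<^sub>M i\<in>{1..n}. gaussian (\<nu> i) \<tau>) (\<Pi>\<^sub>M i\<in>{1..n}. borel) (\<lambda>z. \<lambda>i\<in>{1..n}. x i + z i)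
    = (\<Pi>\<^sub>M i\<in>{1..n}. distr (gaussian (\<nu> i) \<tau>) borel ((+) (x i)))"
    by (rule distr_PiM_componentwise) (auto intro: prob_space_gaussian assms)
  then show ?thesis by (simp add: distr_gaussian_shift)
qed

lemma gaussian_moments:
  assumes "0 < \<sigma>"
  shows "integrable (gaussian 0 \<sigma>) (\<lambda>x. x)" "(\<integral>x. x \<partial>gaussian 0 \<sigma>) = 0"
    "integrable (gaussian 0 \<sigma>) (\<lambda>x. x\<^sup>2)" "(\<integral>x. x\<^sup>2 \<partial>gaussian 0 \<sigma>) = \<sigma>\<^sup>2"
proof -
  show "integrable (gaussian 0 \<sigma>) (\<lambda>x. x)" "integrable (gaussian 0 \<sigma>) (\<lambda>x. x\<^sup>2)"
    using integrable_normal_moment[OF assms, of 0 1] integrable_normal_moment[OF assms, of 0 2]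
    by (simp_all add: gaussian_def integrable_density)
  show "(\<integral>x. x \<partial>gaussian 0 \<sigma>) = 0" "(\<integral>x. x\<^sup>2 \<partial>gaussian 0 \<sigma>) = \<sigma>\<^sup>2"
    using integral_normal_moment_odd[OF assms, of 0 0] integral_normal_moment_even[OF assms, of 0 1]
    by (simp_all add: gaussian_def integral_density)
qed

lemma gaussian_noise_component:
  fixes f :: "real \<Rightarrow> real"
  assumes "0 < \<sigma>" "i \<in> {1..n}" "integrable (gaussian 0 \<sigma>) f"
  shows "integrable (gaussian_noise n \<sigma>) (\<lambda>z. f (z i))"
    "(\<integral>z. f (z i) \<partial>gaussian_noise n \<sigma>) = (\<integral>x. f x \<partial>gaussian 0 \<sigma>)"
proof -
  have d: "distr (gaussian_noise n \<sigma>) (gaussian 0 \<sigma>) (\<lambda>z. z i) = gaussian 0 \<sigma>"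
    unfolding gaussian_noise_altdef using assms
    by (intro distr_PiM_component prob_space_gaussian)
  have m: "(\<lambda>z. z i) \<in> gaussian_noise n \<sigma> \<rightarrow>\<^sub>M gaussian 0 \<sigma>"
    unfolding gaussian_noise_altdef using assms(2) by measurable
  show "integrable (gaussian_noise n \<sigma>) (\<lambda>z. f (z i))"
    using assms(3) integrable_distr[OF m, of f] d by simp
  show "(\<integral>z. f (z i) \<partial>gaussian_noise n \<sigma>) = (\<integral>x. f x \<partial>gaussian 0 \<sigma>)"
    using integral_distr[OF m, of f] assms(3) d by (simp add: borel_measurable_integrable)
qed

text \<open>Donsker--Varadhan for the function \<open>L * indicator E\<close>, with \<open>g\<close> the log-likelihood ratio
  of \<open>M\<close> to the reference law; it follows from \<open>x - ln 2 \<le> exp x / 2 - 1\<close>.\<close>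

lemma (in prob_space) change_of_measure_bound:
  fixes g :: "'a \<Rightarrow> real"
  assumes Q: "prob_space (density M (\<lambda>z. ennreal (exp (- g z))))"
    and g: "integrable M g" and E: "E \<in> events"
  shows "L * prob E \<le> expectation g + ln 2 - 1 / 2
    + exp L / 2 * measure (density M (\<lambda>z. ennreal (exp (- g z)))) E"
proof -
  let ?Q = "density M (\<lambda>z. ennreal (exp (- g z)))"
  interpret Q: prob_space ?Q by (rule Q)
  have [measurable]: "g \<in> borel_measurable M" "E \<in> sets M" using g E by auto
  have nn1: "(\<integral>\<^sup>+z. ennreal (exp (- g z)) \<partial>M) = 1"
    using Q.emeasure_space_1 by (simp add: emeasure_density cong: nn_integral_cong)
  have int1: "integrable M (\<lambda>z. exp (- g z))" 
    by (rule integrableI_nonneg) (use nn1 in auto)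
  have eq1: "(\<integral>z. exp (- g z) \<partial>M) = 1"
    by (subst integral_eq_nn_integral) (use nn1 in auto)
  have int2: "integrable M (\<lambda>z. indicator E z * exp (- g z))"
    by (rule Bochner_Integration.integrable_bound[OF int1]) (auto simp: indicator_def)
  have eq2: "(\<integral>z. indicator E z * exp (- g z) \<partial>M) = measure ?Q E"
  proof -
    have "measure ?Q E = (\<integral>z. indicator E z \<partial>?Q)"
      by simp
    also have "\<dots> = (\<integral>z. exp (- g z) * indicator E z \<partial>M)"
      by (subst integral_density) auto
    finally show ?thesis by (simp add: mult.commute)
  qed
  \<comment> \<open>The two exponentials on the right integrate to 1 and to \<open>exp L\<close>
    times the reference mass of \<open>E\<close>. The constants belong to the tangent of
    \<open>ln\<close> at 2, the natural point when \<open>L\<close> is later chosen so that the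
    second integral is on average at most 1.\<close>
  have pt: "L * indicator E z - g z - ln 2 \<le> (exp (- g z) + exp L * (indicator E z * exp (- g z))) / 2 - 1" for z
  proof -
    have "L * indicator E z - g z - ln 2 \<le> exp (L * indicator E z - g z - ln 2) - 1"
      using exp_ge_add_one_self[of "L * indicator E z - g z - ln 2"] by linarith
    also have "exp (L * indicator E z - g z - ln 2) = exp (L * indicator E z - g z) / 2"
      by (simp add: exp_diff)
    also have "exp (L * indicator E z - g z) \<le> exp (- g z) + exp L * (indicator E z * exp (- g z))"
      by (cases "z \<in> E") (auto simp: exp_diff exp_minus field_simps)
    finally show ?thesis by simp
  qed
  have int3: "integrable M (indicator E :: _ \<Rightarrow> real)"
    by (simp add: emeasure_eq_measure)
  have "L * prob E - expectation g - ln 2 = (\<integral>z. L * indicator E z - g z - ln 2 \<partial>M)"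
  proof -
    have "E \<inter> space M = E"
      using E by (rule sets.Int_space_eq2)
    then show ?thesis using g int3 by (simp add: prob_space)
  qed
  also have "\<dots> \<le> (\<integral>z. (exp (- g z) + exp L * (indicator E z * exp (- g z))) / 2 - 1 \<partial>M)"
    by (rule integral_mono) (use g int1 int2 int3 pt in auto)
  also have "\<dots> = (1 + exp L * measure ?Q E) / 2 - 1"
    using int1 int2 eq1 eq2 by (simp add: prob_space)
  finally show ?thesis by (simp add: field_simps)
qed

section \<open>From the measurement model to averages over tuples\<close>

lemma sum_signal:
  assumes S: "S \<in> distinct_tuples k m"
  shows "(\<Sum>s\<in>{1..m}. a s * signal k w S s) = (\<Sum>j\<in>{1..k}. w j * a (S j))"
proof -
  have inj: "inj_on S {1..k}" and sub: "S ` {1..k} \<subseteq> {1..m}"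
    using S by (auto simp: distinct_tuples_def)
  have "(\<Sum>s\<in>{1..m}. a s * signal k w S s) = (\<Sum>s\<in>S ` {1..k}. a s * signal k w S s)"
    by (rule sum.mono_neutral_right) (use sub in \<open>auto simp: signal_def\<close>)
  also have "\<dots> = (\<Sum>j\<in>{1..k}. a (S j) * signal k w S (S j))"
    by (subst sum.reindex[OF inj]) simp
  also have "\<dots> = (\<Sum>j\<in>{1..k}. w j * a (S j))"
    by (intro sum.cong refl) (simp add: signal_at_tuple[OF S])
  finally show ?thesis .
qed

text \<open>Expanding about the mean leaves the sum of squares minus \<open>m\<close> times the
  squared mean. Thus rows of \<open>A\<close> may be centred without weakening the Frobenius
  bound.\<close>

lemma sum_square_deviation_le:
  fixes a :: "nat \<Rightarrow> real"
  shows "(\<Sum>s\<in>{1..m}. (a s - (\<Sum>r\<in>{1..m}. a r) / real m)\<^sup>2) \<le> (\<Sum>s\<in>{1..m}. (a s)\<^sup>2)"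
proof (cases "m = 0")
  case False
  define \<mu> where "\<mu> = (\<Sum>r\<in>{1..m}. a r) / real m"
  have "(\<Sum>s\<in>{1..m}. (a s - \<mu>)\<^sup>2) = (\<Sum>s\<in>{1..m}. (a s)\<^sup>2) - 2 * \<mu> * (\<Sum>s\<in>{1..m}. a s) + real m * \<mu>\<^sup>2"
    by (simp add: power2_diff sum.distrib sum_subtractf sum_distrib_left mult_ac)
  also have "(\<Sum>s\<in>{1..m}. a s) = real m * \<mu>"
    using False by (simp add: \<mu>_def)
  also have "(\<Sum>s\<in>{1..m}. (a s)\<^sup>2) - 2 * \<mu> * (real m * \<mu>) + real m * \<mu>\<^sup>2
      = (\<Sum>s\<in>{1..m}. (a s)\<^sup>2) - real m * \<mu>\<^sup>2"
    by (simp add: power2_eq_square)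
  also have "\<dots> \<le> (\<Sum>s\<in>{1..m}. (a s)\<^sup>2)"
    by simp
  finally show ?thesis by (simp add: \<mu>_def)
qed simp

text \<open>The complement of the error event is a disjoint union of slices over the equally likely
  tuples; nonzero weights identify the support with the range of the tuple. The second claim gives
  measurability of the slices.\<close>

lemma one_minus_avg_error_prob:
  assumes "k \<le> m" "0 < \<sigma>" and w: "\<And>j. j \<in> {1..k} \<Longrightarrow> w j \<noteq> 0"
    and d: "support_recovery_map n m d"
  shows "(1 - avg_error_prob k n m \<sigma> w A d) * real (card (distinct_tuples k m)) =
    (\<Sum>S\<in>distinct_tuples k m. measure (gaussian_noise n \<sigma>)
      {Z \<in> space (gaussian_noise n \<sigma>). d (measurement n m A (signal k w S) Z) = S ` {1..k}})"
    (is "_ = (\<Sum>S\<in>?D. measure ?G (?C S))")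
    and "\<And>S. {Z \<in> space (gaussian_noise n \<sigma>). d (measurement n m A (signal k w S) Z) = S ` {1..k}}
      \<in> sets (gaussian_noise n \<sigma>)"
proof -
  let ?J = "joint_law k n m \<sigma>" and ?U = "uniform_count_measure ?D"
  interpret J: prob_space ?J by (rule prob_space_joint_law[OF assms(1,2)])
  interpret G: prob_space ?G by (rule prob_space_gaussian_noise[OF assms(2)])
  have meas: "(\<lambda>Z. d (measurement n m A (signal k w S) Z)) \<in> ?G \<rightarrow>\<^sub>M count_space (Pow {1..m})" for S
  proof -
    have "measurement n m A (signal k w S) \<in> ?G \<rightarrow>\<^sub>M (\<Pi>\<^sub>M i\<in>{1..n}. borel)"
      unfolding measurement_def measurable_cong_sets[OF sets_gaussian_noise refl]
      by (intro measurable_restrict borel_measurable_add) (auto intro: measurable_component_singleton)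
    then show ?thesis
      by (rule measurable_compose[OF _ d[unfolded support_recovery_map_def]])
  qed
  show C: "?C S \<in> sets ?G" for S
  proof -
    have "(\<lambda>Z. d (measurement n m A (signal k w S) Z)) -` (Pow {1..m} \<inter> {S ` {1..k}}) \<inter> space ?G \<in> sets ?G"
      by (rule measurable_sets[OF meas]) simp
    moreover have "(\<lambda>Z. d (measurement n m A (signal k w S) Z)) -` (Pow {1..m} \<inter> {S ` {1..k}}) \<inter> space ?G = ?C S"
      using measurable_space[OF meas] by auto
    ultimately show ?thesis by simp
  qed
  have spJ: "space ?J = ?D \<times> space ?G"
    by (simp add: joint_law_def space_pair_measure space_uniform_count_measure)
  have "1 - avg_error_prob k n m \<sigma> w A d = J.prob (space ?J - error_event k n m \<sigma> w A d)"
    unfolding avg_error_prob_def by (rule J.prob_compl[symmetric]) (rule error_event_measurable[OF d])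
  also have "space ?J - error_event k n m \<sigma> w A d = (\<Union>S\<in>?D. {S} \<times> ?C S)"
    using supp_signal[OF _ w] by (auto simp: spJ error_event_def)
  also have "J.prob \<dots> = (\<Sum>S\<in>?D. J.prob ({S} \<times> ?C S))"
  proof (rule J.finite_measure_finite_Union)
    show "(\<lambda>S. {S} \<times> ?C S) ` ?D \<subseteq> J.events"
      unfolding joint_law_def using C by (auto intro!: pair_measureI simp: sets_uniform_count_measure)
  qed (auto simp: finite_distinct_tuples disjoint_family_on_def)
  also have "\<dots> = (\<Sum>S\<in>?D. 1 / real (card ?D) * G.prob (?C S))"
  proof (intro sum.cong refl)
    fix S assume S: "S \<in> ?D"
    have "emeasure ?J ({S} \<times> ?C S) = emeasure ?U {S} * emeasure ?G (?C S)"
      unfolding joint_law_def by (rule G.emeasure_pair_measure_Times)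
        (use S C in \<open>auto simp: sets_uniform_count_measure\<close>)
    then show "J.prob ({S} \<times> ?C S) = 1 / real (card ?D) * G.prob (?C S)"
      using S measure_uniform_count_measure[OF finite_distinct_tuples, of "{S}" k m]
      unfolding measure_def by (simp add: enn2real_mult)
  qed
  finally show "(1 - avg_error_prob k n m \<sigma> w A d) * real (card ?D) = (\<Sum>S\<in>?D. G.prob (?C S))"
    using distinct_tuples_nonempty[OF assms(1)] finite_distinct_tuples[of k m]
    by (simp add: sum_divide_distrib[symmetric])
qed

text \<open>\<open>- ln\<close> of the product in \<open>gaussian_noise_change_of_measure\<close> for \<open>\<nu> = - \<delta>\<close>.\<close>

definition log_likelihood_ratio ::
    "nat \<Rightarrow> real \<Rightarrow> real \<Rightarrow> (nat \<Rightarrow> real) \<Rightarrow> (nat \<Rightarrow> real) \<Rightarrow> real" where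
  "log_likelihood_ratio n \<sigma> \<tau> \<delta> z =
    (\<Sum>i\<in>{1..n}. ln (\<tau> / \<sigma>) - (z i)\<^sup>2 / (2 * \<sigma>\<^sup>2) + (z i + \<delta> i)\<^sup>2 / (2 * \<tau>\<^sup>2))"

lemma exp_log_likelihood_ratio:
  assumes "0 < \<sigma>" "0 < \<tau>"
  shows "exp (- log_likelihood_ratio n \<sigma> \<tau> \<delta> z) =
    (\<Prod>i\<in>{1..n}. normal_density (- \<delta> i) \<tau> (z i) / normal_density 0 \<sigma> (z i))"
  unfolding log_likelihood_ratio_def sum_negf[symmetric] exp_sum[OF finite_atLeastAtMost]
proof (intro prod.cong refl)
  fix i
  have "sqrt (2 * pi * \<tau>\<^sup>2) = sqrt (2 * pi) * \<tau>" "sqrt (2 * pi * \<sigma>\<^sup>2) = sqrt (2 * pi) * \<sigma>"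
    using assms by (simp_all add: real_sqrt_mult)
  then have "normal_density (- \<delta> i) \<tau> (z i) / normal_density 0 \<sigma> (z i) =
      (\<sigma> / \<tau>) * (exp (- (z i + \<delta> i)\<^sup>2 / (2 * \<tau>\<^sup>2)) / exp (- (z i)\<^sup>2 / (2 * \<sigma>\<^sup>2)))"
    using assms by (simp add: normal_density_def)
  also have "\<sigma> / \<tau> = exp (- ln (\<tau> / \<sigma>))"
    using assms by (simp add: exp_minus)
  finally show "exp (- (ln (\<tau> / \<sigma>) - (z i)\<^sup>2 / (2 * \<sigma>\<^sup>2) + (z i + \<delta> i)\<^sup>2 / (2 * \<tau>\<^sup>2))) =
      normal_density (- \<delta> i) \<tau> (z i) / normal_density 0 \<sigma> (z i)"
    by (simp add: exp_add[symmetric] exp_diff[symmetric])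
qed

text \<open>The integral is the relative entropy of the noise law with respect to independent
  Gaussians of means \<open>- \<delta> i\<close> and standard deviation \<open>\<tau>\<close>; the
  summands are quadratic in \<open>z i\<close>, so only the first two moments enter.\<close>

lemma integral_log_likelihood_ratio:
  assumes "0 < \<sigma>" "0 < \<tau>"
  shows "integrable (gaussian_noise n \<sigma>) (log_likelihood_ratio n \<sigma> \<tau> \<delta>)"
    and "(\<integral>z. log_likelihood_ratio n \<sigma> \<tau> \<delta> z \<partial>gaussian_noise n \<sigma>) =
      real n * (ln (\<tau> / \<sigma>) - 1 / 2 + \<sigma>\<^sup>2 / (2 * \<tau>\<^sup>2)) + (\<Sum>i\<in>{1..n}. (\<delta> i)\<^sup>2) / (2 * \<tau>\<^sup>2)"
proof -
  interpret G: prob_space "gaussian 0 \<sigma>" by (rule prob_space_gaussian[OF assms(1)])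
  note mom = gaussian_moments[OF assms(1)]
  define f where "f = (\<lambda>i x. ln (\<tau> / \<sigma>) - x\<^sup>2 / (2 * \<sigma>\<^sup>2) + (x\<^sup>2 + 2 * \<delta> i * x + (\<delta> i)\<^sup>2) / (2 * \<tau>\<^sup>2))"
  have f: "integrable (gaussian 0 \<sigma>) (f i)" for i
    unfolding f_def using mom by simp
  have "(\<integral>x. f i x \<partial>gaussian 0 \<sigma>) = ln (\<tau> / \<sigma>) - \<sigma>\<^sup>2 / (2 * \<sigma>\<^sup>2) + (\<sigma>\<^sup>2 + (\<delta> i)\<^sup>2) / (2 * \<tau>\<^sup>2)" for i
    unfolding f_def using mom G.prob_space by simp
  then have f': "(\<integral>x. f i x \<partial>gaussian 0 \<sigma>) = (ln (\<tau> / \<sigma>) - 1 / 2 + \<sigma>\<^sup>2 / (2 * \<tau>\<^sup>2)) + (\<delta> i)\<^sup>2 / (2 * \<tau>\<^sup>2)" for i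
    using assms by (simp add: add_divide_distrib)
  have llr: "log_likelihood_ratio n \<sigma> \<tau> \<delta> = (\<lambda>z. \<Sum>i\<in>{1..n}. f i (z i))"
    by (simp add: fun_eq_iff log_likelihood_ratio_def f_def power2_sum algebra_simps)
  show "integrable (gaussian_noise n \<sigma>) (log_likelihood_ratio n \<sigma> \<tau> \<delta>)"
    unfolding llr by (intro Bochner_Integration.integrable_sum gaussian_noise_component assms f)
  show "(\<integral>z. log_likelihood_ratio n \<sigma> \<tau> \<delta> z \<partial>gaussian_noise n \<sigma>) =
      real n * (ln (\<tau> / \<sigma>) - 1 / 2 + \<sigma>\<^sup>2 / (2 * \<tau>\<^sup>2)) + (\<Sum>i\<in>{1..n}. (\<delta> i)\<^sup>2) / (2 * \<tau>\<^sup>2)"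
    unfolding llr
    by (subst Bochner_Integration.integral_sum)
      (auto simp: gaussian_noise_component assms f f' sum.distrib sum_divide_distrib)
qed

text \<open>The change of measure is made on the noise: reference noise centred at
  \<open>\<nu> - x\<close> is translated by \<open>x\<close> into observations centred at
  \<open>\<nu>\<close>. So the last term does not involve \<open>x\<close>, which allows all tuples
  with the same revealed part to be compared with one law.\<close>

lemma correct_decoding_bound:
  assumes "0 < \<sigma>" "0 < \<tau>"
    and d: "support_recovery_map n m d"
  shows "L * measure (gaussian_noise n \<sigma>)
      {z \<in> space (gaussian_noise n \<sigma>). d (\<lambda>i\<in>{1..n}. x i + z i) = B} \<le>
    real n * (ln (\<tau> / \<sigma>) - 1 / 2 + \<sigma>\<^sup>2 / (2 * \<tau>\<^sup>2))
      + (\<Sum>i\<in>{1..n}. (x i - \<nu> i)\<^sup>2) / (2 * \<tau>\<^sup>2) + ln 2 - 1 / 2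
      + exp L / 2 * measure (\<Pi>\<^sub>M i\<in>{1..n}. gaussian (\<nu> i) \<tau>)
          {y \<in> space (\<Pi>\<^sub>M i\<in>{1..n}. gaussian (\<nu> i) \<tau>). d y = B}"
    (is "L * measure ?G ?E \<le> _")
    and "{y \<in> space (\<Pi>\<^sub>M i\<in>{1..n}. gaussian (\<nu> i) \<tau>). d y = B} \<in> sets (\<Pi>\<^sub>M i\<in>{1..n}. gaussian (\<nu> i) \<tau>)"
proof -
  interpret G: prob_space ?G by (rule prob_space_gaussian_noise[OF assms(1)])
  define \<delta> where "\<delta> = (\<lambda>i. x i - \<nu> i)"
  define g where "g = log_likelihood_ratio n \<sigma> \<tau> \<delta>"
  let ?P = "\<Pi>\<^sub>M i\<in>{1..n}. (borel :: real measure)"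
  let ?R = "\<Pi>\<^sub>M i\<in>{1..n}. gaussian (- \<delta> i) \<tau>" and ?Q = "\<Pi>\<^sub>M i\<in>{1..n}. gaussian (\<nu> i) \<tau>"
  let ?sh = "\<lambda>z. \<lambda>i\<in>{1..n}. x i + z i" and ?E' = "{y \<in> space ?P. d y = B}"
  have dens: "density ?G (\<lambda>z. ennreal (exp (- g z))) = ?R"
    unfolding g_def exp_log_likelihood_ratio[OF assms(1,2)]
    by (rule gaussian_noise_change_of_measure[OF assms(1,2)])
  have sQ: "sets ?R = sets ?P" "sets ?Q = sets ?P" "sets ?G = sets ?P"
    by (simp_all cong: sets_PiM_cong add: sets_gaussian_noise)
  have spQ: "space ?R = space ?P" "space ?Q = space ?P" "space ?G = space ?P"
    using sQ by (auto dest: sets_eq_imp_space_eq)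
  have E': "?E' \<in> sets ?P"
  proof -
    have dm: "d \<in> ?P \<rightarrow>\<^sub>M count_space (Pow {1..m})"
      using d by (simp add: support_recovery_map_def)
    have "d -` (Pow {1..m} \<inter> {B}) \<inter> space ?P \<in> sets ?P"
      by (rule measurable_sets[OF dm]) simp
    moreover have "d -` (Pow {1..m} \<inter> {B}) \<inter> space ?P = ?E'"
      using measurable_space[OF dm] by auto
    ultimately show ?thesis by simp
  qed
  then show "{y \<in> space ?Q. d y = B} \<in> sets ?Q"
    by (simp only: sQ spQ)
  have sh: "?sh \<in> ?P \<rightarrow>\<^sub>M ?P"
    by (intro measurable_restrict borel_measurable_add) (auto intro: measurable_component_singleton)
  \<comment> \<open>The correct-decoding event for the noise is the preimage, under the shift by
    \<open>x\<close>, of the one for the observation.\<close>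
  have vim: "?sh -` ?E' \<inter> space ?P = ?E"
    using measurable_space[OF sh] by (auto simp: spQ)
  have E: "?E \<in> sets ?G"
    using measurable_sets[OF sh E'] by (simp only: vim sQ)
  have "measure ?R ?E = measure (distr ?R ?P ?sh) ?E'"
    using sh E' by (subst measure_distr) (simp_all only: vim spQ measurable_cong_sets[OF sQ(1) refl])
  also have "distr ?R ?P ?sh = ?Q"
    by (subst distr_gaussian_PiM_shift[OF assms(2)]) (simp add: \<delta>_def)
  finally have meq: "measure ?R ?E = measure ?Q {y \<in> space ?Q. d y = B}"
    by (simp only: spQ)
  have "L * measure ?G ?E \<le> (\<integral>z. g z \<partial>?G) + ln 2 - 1 / 2
      + exp L / 2 * measure (density ?G (\<lambda>z. ennreal (exp (- g z)))) ?E"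
  proof (rule G.change_of_measure_bound)
    show "prob_space (density ?G (\<lambda>z. ennreal (exp (- g z))))"
      unfolding dens by (intro prob_space_PiM prob_space_gaussian assms)
    show "integrable ?G g" unfolding g_def by (rule integral_log_likelihood_ratio[OF assms(1,2)])
  qed (rule E)
  then show "L * measure ?G ?E \<le>
    real n * (ln (\<tau> / \<sigma>) - 1 / 2 + \<sigma>\<^sup>2 / (2 * \<tau>\<^sup>2))
      + (\<Sum>i\<in>{1..n}. (x i - \<nu> i)\<^sup>2) / (2 * \<tau>\<^sup>2) + ln 2 - 1 / 2
      + exp L / 2 * measure ?Q {y \<in> space ?Q. d y = B}"
    unfolding dens meq unfolding g_def integral_log_likelihood_ratio(2)[OF assms(1,2)] \<delta>_def .
qed

section \<open>The converse bound\<close>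

text \<open>Sums \<open>correct_decoding_bound\<close> over all tuples; \<open>L\<close> is the
  logarithm of the inverse of the guessing bound \<open>(k / (m - k + 1)) ^ card T\<close>, so that
  the reference terms sum to at most half the number of tuples.\<close>

lemma support_recovery_converse:
  fixes w :: "nat \<Rightarrow> real" and \<sigma>\<^sub>a \<sigma>\<^sub>z :: real
  assumes "1 \<le> k" "k \<le> m" "2 \<le> m" "0 < n" "0 < \<sigma>\<^sub>z" "T \<subseteq> {1..k}"
    and w: "\<And>j. j \<in> {1..k} \<Longrightarrow> w j \<noteq> 0"
    and d: "support_recovery_map n m d"
    and A: "1 / (real n * real m) * (frobenius_norm n m A)\<^sup>2 \<le> \<sigma>\<^sub>a\<^sup>2"
  shows "(1 - avg_error_prob k n m \<sigma>\<^sub>z w A d) * (real (card T) * ln ((real (m - k) + 1) / real k)) \<le>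
    real n / 2 * ln (1 + \<sigma>\<^sub>a\<^sup>2 / \<sigma>\<^sub>z\<^sup>2 * (\<Sum>j\<in>T. (w j)\<^sup>2) * (real m / (real m - 1))) + ln 2"
proof -
  let ?D = "distinct_tuples k m"
  define N where "N = real (card ?D)"
  define W where "W = (\<Sum>j\<in>T. (w j)\<^sup>2)"
  \<comment> \<open>\<open>P\<close> bounds the mean squared deviation per measurement, so the
    reference variance is chosen as noise variance plus \<open>P\<close>.\<close>
  define P where "P = \<sigma>\<^sub>a\<^sup>2 * W * (real m / (real m - 1))"
  define \<tau> where "\<tau> = sqrt (\<sigma>\<^sub>z\<^sup>2 + P)"
  define \<mu> where "\<mu> = (\<lambda>i. (\<Sum>s\<in>{1..m}. A i s) / real m)"
  \<comment> \<open>The reference mean keeps the revealed entries of each row and replaces the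
    hidden ones by the row average.\<close>
  define \<nu> where "\<nu> = (\<lambda>r i. (\<Sum>j\<in>{1..k} - T. w j * A i (r j)) + (\<Sum>j\<in>T. w j * \<mu> i))"
  define Q where "Q = (\<lambda>r. \<Pi>\<^sub>M i\<in>{1..n}. gaussian (\<nu> r i) \<tau>)"
  define x where "x = (\<lambda>S i. \<Sum>s\<in>{1..m}. A i s * signal k w S s)"
  define L where "L = real (card T) * ln ((real (m - k) + 1) / real k)"
  define pc where "pc = 1 - avg_error_prob k n m \<sigma>\<^sub>z w A d"
  define R where "R = (\<lambda>S::nat \<Rightarrow> nat. restrict S ({1..k} - T))"
  define q where "q = (\<lambda>S. measure (Q (R S)) {y \<in> space (Q (R S)). d y = S ` {1..k}})"
  define \<Delta> where "\<Delta> = (\<lambda>S. \<Sum>i\<in>{1..n}. (x S i - \<nu> (R S) i)\<^sup>2)"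
  have N: "0 < N"
    using distinct_tuples_nonempty[OF assms(2)] finite_distinct_tuples[of k m]
    by (simp add: N_def card_gt_0_iff)
  have W: "0 \<le> W" by (simp add: W_def sum_nonneg)
  have P: "0 \<le> P" using W assms(3) by (simp add: P_def)
  have z: "0 < \<sigma>\<^sub>z\<^sup>2" using assms(5) by simp
  have \<tau>: "0 < \<tau>" "\<tau>\<^sup>2 = \<sigma>\<^sub>z\<^sup>2 + P"
    using add_pos_nonneg[OF z P] by (simp_all add: \<tau>_def)
  have dev: "x S i - \<nu> (R S) i = (\<Sum>j\<in>T. w j * (A i (S j) - \<mu> i))" if S: "S \<in> ?D" for S i
  proof -
    have "x S i = (\<Sum>j\<in>{1..k}. w j * A i (S j))"
      unfolding x_def by (rule sum_signal[OF S])
    also have "\<dots> = (\<Sum>j\<in>{1..k} - T. w j * A i (S j)) + (\<Sum>j\<in>T. w j * A i (S j))"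
      by (rule sum.subset_diff[OF assms(6)]) simp
    finally show ?thesis
      by (simp add: \<nu>_def R_def sum_subtractf right_diff_distrib)
  qed
  have "(\<Sum>S\<in>?D. \<Delta> S) = (\<Sum>i\<in>{1..n}. \<Sum>S\<in>?D. (x S i - \<nu> (R S) i)\<^sup>2)"
    unfolding \<Delta>_def by (rule sum.swap)
  also have "\<dots> = (\<Sum>i\<in>{1..n}. \<Sum>S\<in>?D. (\<Sum>j\<in>T. w j * (A i (S j) - \<mu> i))\<^sup>2)"
    by (intro sum.cong refl) (simp only: dev)
  \<comment> \<open>Centring makes each row sum to zero, so the bound for sampling without
    replacement applies; \<open>sum_square_deviation_le\<close> then returns to the uncentred
    row.\<close>
  also have "\<dots> \<le> (\<Sum>i\<in>{1..n}. N / (real m - 1) * W * (\<Sum>s\<in>{1..m}. (A i s)\<^sup>2))"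
  proof (intro sum_mono)
    fix i
    have "(\<Sum>S\<in>?D. (\<Sum>j\<in>T. w j * (A i (S j) - \<mu> i))\<^sup>2) \<le>
        N / (real m - 1) * W * (\<Sum>s\<in>{1..m}. (A i s - \<mu> i)\<^sup>2)"
      unfolding N_def W_def
      by (rule sum_distinct_tuples_square_le[OF assms(2,6,3)])
        (use assms(3) in \<open>simp add: sum_subtractf \<mu>_def\<close>)
    also have "\<dots> \<le> N / (real m - 1) * W * (\<Sum>s\<in>{1..m}. (A i s)\<^sup>2)"
      unfolding \<mu>_def using N W assms(3)
      by (intro mult_left_mono sum_square_deviation_le) simp
    finally show "(\<Sum>S\<in>?D. (\<Sum>j\<in>T. w j * (A i (S j) - \<mu> i))\<^sup>2) \<le> \<dots>" .
  qed
  also have "\<dots> = N / (real m - 1) * W * (frobenius_norm n m A)\<^sup>2"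
    unfolding frobenius_norm_def by (simp add: sum_nonneg sum_distrib_left)
  also have "\<dots> \<le> N / (real m - 1) * W * (\<sigma>\<^sub>a\<^sup>2 * (real n * real m))"
    using A N W assms(2-4) by (intro mult_left_mono) (simp_all add: field_simps)
  also have "\<dots> = N * real n * P" by (simp add: P_def)
  finally have \<Delta>: "(\<Sum>S\<in>?D. \<Delta> S) \<le> N * real n * P" .
  have Q: "prob_space (Q r)" for r
    unfolding Q_def by (intro prob_space_PiM prob_space_gaussian \<tau>)
  \<comment> \<open>\<open>Q (R S)\<close> depends on the tuple only through its revealed part, as
    \<open>sum_correct_reference_le\<close> demands.\<close>
  have "(\<Sum>S\<in>?D. q S) * (real (m - k) + 1) ^ card T \<le> N * real k ^ card T"
    unfolding q_def R_def N_def
    by (rule sum_correct_reference_le[OF assms(2,6) Q])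
      (unfold Q_def, rule correct_decoding_bound(2)[OF assms(5) \<tau>(1) d])
  moreover have "exp L = (real (m - k) + 1) ^ card T / real k ^ card T"
    using assms(1) by (simp add: L_def exp_of_nat_mult power_divide)
  moreover have kT: "0 < real k ^ card T"
    using assms(1) by simp
  ultimately have "(\<Sum>S\<in>?D. q S) * (exp L * real k ^ card T) \<le> N * real k ^ card T"
    by (metis less_irrefl nonzero_eq_divide_eq)
  then have "exp L * (\<Sum>S\<in>?D. q S) * real k ^ card T \<le> N * real k ^ card T"
    by (simp only: mult_ac)
  then have q: "exp L * (\<Sum>S\<in>?D. q S) \<le> N"
    using kT by (rule mult_right_le_imp_le)
  define c where "c = real n * (ln (\<tau> / \<sigma>\<^sub>z) - 1 / 2 + \<sigma>\<^sub>z\<^sup>2 / (2 * \<tau>\<^sup>2)) + ln 2 - 1 / 2"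
  have "L * (pc * N) = (\<Sum>S\<in>?D. L * measure (gaussian_noise n \<sigma>\<^sub>z)
      {Z \<in> space (gaussian_noise n \<sigma>\<^sub>z). d (measurement n m A (signal k w S) Z) = S ` {1..k}})"
    unfolding pc_def N_def using one_minus_avg_error_prob(1)[OF assms(2,5) w d]
    by (simp add: sum_distrib_left)
  also have "\<dots> \<le> (\<Sum>S\<in>?D. c + \<Delta> S / (2 * \<tau>\<^sup>2) + exp L / 2 * q S)"
  proof (intro sum_mono)
    fix S
    show "L * measure (gaussian_noise n \<sigma>\<^sub>z)
        {Z \<in> space (gaussian_noise n \<sigma>\<^sub>z). d (measurement n m A (signal k w S) Z) = S ` {1..k}}
      \<le> c + \<Delta> S / (2 * \<tau>\<^sup>2) + exp L / 2 * q S"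
      using correct_decoding_bound(1)[OF assms(5) \<tau>(1) d, of L "x S" "S ` {1..k}" "\<nu> (R S)"]
      unfolding measurement_def c_def \<Delta>_def q_def Q_def x_def by linarith
  qed
  also have "\<dots> = N * c + (\<Sum>S\<in>?D. \<Delta> S) / (2 * \<tau>\<^sup>2) + exp L * (\<Sum>S\<in>?D. q S) / 2"
    by (simp add: sum.distrib N_def sum_divide_distrib sum_distrib_left)
  also have "\<dots> \<le> N * c + N * real n * P / (2 * \<tau>\<^sup>2) + N / 2"
    using \<Delta> q \<tau>(1) by (intro add_mono divide_right_mono) simp_all
  \<comment> \<open>By the choice of \<open>\<tau>\<close>, the fractions with numerators
    \<open>\<sigma>\<^sub>z\<^sup>2\<close> and \<open>P\<close> add up to \<open>1 / 2\<close> per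
    measurement and cancel the \<open>- 1 / 2\<close> there; likewise \<open>N / 2\<close> cancels
    the last \<open>- 1 / 2\<close> of \<open>c\<close>.\<close>
  also have "\<dots> = N * (real n * ln (\<tau> / \<sigma>\<^sub>z) + ln 2)"
  proof -
    define u where "u = P / (2 * \<tau>\<^sup>2)"
    have "\<sigma>\<^sub>z\<^sup>2 / (2 * \<tau>\<^sup>2) + u = \<tau>\<^sup>2 / (2 * \<tau>\<^sup>2)"
      by (simp only: u_def \<tau>(2) add_divide_distrib[symmetric])
    also have "\<dots> = 1 / 2"
      using \<tau>(1) by simp
    finally have "\<sigma>\<^sub>z\<^sup>2 / (2 * \<tau>\<^sup>2) = 1 / 2 - u"
      by simp
    moreover have "N * real n * P / (2 * \<tau>\<^sup>2) = N * real n * u"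
      by (simp add: u_def)
    ultimately show ?thesis
      unfolding c_def by (simp only:) (simp add: algebra_simps)
  qed
  finally have "N * (L * pc) \<le> N * (real n * ln (\<tau> / \<sigma>\<^sub>z) + ln 2)" by (simp add: mult_ac)
  then have "L * pc \<le> real n * ln (\<tau> / \<sigma>\<^sub>z) + ln 2"
    using N by simp
  moreover have "ln (\<tau> / \<sigma>\<^sub>z) = ln (1 + P / \<sigma>\<^sub>z\<^sup>2) / 2"
  proof -
    have "2 * ln (\<tau> / \<sigma>\<^sub>z) = ln ((\<tau> / \<sigma>\<^sub>z)\<^sup>2)"
      using \<tau> assms(5) by (simp add: ln_realpow)
    also have "(\<tau> / \<sigma>\<^sub>z)\<^sup>2 = 1 + P / \<sigma>\<^sub>z\<^sup>2"
      using \<tau> z by (simp add: power_divide field_simps)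
    finally show ?thesis by simp
  qed
  ultimately show ?thesis
    unfolding L_def pc_def P_def W_def by (simp add: mult_ac)
qed

section \<open>Passage to the limit\<close>

lemma support_recovery_rate_le:
  fixes k :: nat and w :: "nat \<Rightarrow> real" and \<sigma>\<^sub>a \<sigma>\<^sub>z b :: real
    and n :: "nat \<Rightarrow> nat"
    and A :: "nat \<Rightarrow> nat \<Rightarrow> nat \<Rightarrow> real"
    and d :: "nat \<Rightarrow> (nat \<Rightarrow> real) \<Rightarrow> nat set"
  assumes "k \<ge> 1"
    and w: "\<And>i. i \<in> {1..k} \<Longrightarrow> w i \<noteq> 0"
    and "\<sigma>\<^sub>z > 0"
    and "b > 1"
    and n: "\<And>m. m \<ge> k \<Longrightarrow> n m > 0"
    and d: "\<And>m. m \<ge> k \<Longrightarrow> support_recovery_map (n m) m (d m)"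
    and A: "\<And>m. m \<ge> k \<Longrightarrow> 1 / (real (n m) * real m) * (frobenius_norm (n m) m (A m))\<^sup>2 \<le> \<sigma>\<^sub>a\<^sup>2"
    and err: "(\<lambda>m. avg_error_prob k (n m) m \<sigma>\<^sub>z w (A m) (d m)) \<longlonglongrightarrow> 0"
    and T: "T \<noteq> {}" "T \<subseteq> {1..k}"
  shows "limsup (\<lambda>m. ereal (log b (real m) / real (n m)))
           \<le> ereal (1 / (2 * real (card T)) * log b (1 + \<sigma>\<^sub>a\<^sup>2 / \<sigma>\<^sub>z\<^sup>2 * (\<Sum>j\<in>T. (w j)\<^sup>2)))"
proof -
  define t where "t = real (card T)"
  define W where "W = (\<Sum>j\<in>T. (w j)\<^sup>2)"
  define e where "e = (\<lambda>m. avg_error_prob k (n m) m \<sigma>\<^sub>z w (A m) (d m))"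
  define S where "S = \<sigma>\<^sub>a\<^sup>2 / \<sigma>\<^sub>z\<^sup>2 * W"
  \<comment> \<open>\<open>C\<close> and \<open>f\<close> rearrange the converse into
    \<open>log b m / n m * f m \<le> C m\<close>, where \<open>f\<close> tends to 1 and
    \<open>C\<close> to the bound for \<open>T\<close>.\<close>
  define C where "C = (\<lambda>m. 1 / (2 * t) * (ln (1 + S * (real m / (real m - 1))) / ln b))"
  define f where "f = (\<lambda>m. (1 - e m) * (ln ((real (m - k) + 1) / real k) / ln (real m)) - ln 2 / t * (1 / ln (real m)))"
  have t: "0 < t"
    using T finite_subset[of T "{1..k}"] by (simp add: t_def card_gt_0_iff)
  have S: "0 \<le> S" by (simp add: S_def W_def sum_nonneg)
  have lnb: "0 < ln b" using assms(4) by simp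
  \<comment> \<open>The limit is computed with the real difference \<open>real m - real k\<close>;
    the truncated one coincides with it for \<open>m \<ge> k\<close>.\<close>
  have lim1: "(\<lambda>m. ln ((real (m - k) + 1) / real k) / ln (real m)) \<longlonglongrightarrow> 1"
  proof (rule Lim_transform_eventually)
    have "0 < real k" using assms(1) by simp
    then show "(\<lambda>m. ln ((real m - real k + 1) / real k) / ln (real m)) \<longlonglongrightarrow> 1"
      by real_asymp
    show "\<forall>\<^sub>F m in sequentially. ln ((real m - real k + 1) / real k) / ln (real m) =
        ln ((real (m - k) + 1) / real k) / ln (real m)"
      using eventually_ge_at_top[of k] by eventually_elim (simp add: of_nat_diff)
  qed
  have lim2: "(\<lambda>m. 1 / ln (real m)) \<longlonglongrightarrow> 0" by real_asymp
  have lim3: "(\<lambda>m. real m / (real m - 1)) \<longlonglongrightarrow> 1" by real_asymp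
  have f: "f \<longlonglongrightarrow> (1 - 0) * 1 - ln 2 / t * 0"
    unfolding f_def by (intro tendsto_intros lim1 lim2 err[folded e_def])
  have C: "C \<longlonglongrightarrow> 1 / (2 * t) * (ln (1 + S * 1) / ln b)"
    unfolding C_def using S lnb by (intro tendsto_intros lim3) auto
  have lim: "(\<lambda>m. C m / f m) \<longlonglongrightarrow> 1 / (2 * t) * log b (1 + S)"
    using tendsto_divide[OF C f] by (simp add: log_def)
  \<comment> \<open>Since \<open>f\<close> tends to 1 it is eventually positive, which permits
    division by it.\<close>
  have "\<forall>\<^sub>F m in sequentially. 0 < f m"
    using order_tendstoD(1)[OF f, of 0] by simp
  then have "\<forall>\<^sub>F m in sequentially. ereal (log b (real m) / real (n m)) \<le> ereal (C m / f m)"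
    using eventually_ge_at_top[of k] eventually_ge_at_top[of 2]
  proof eventually_elim
    case (elim m)
    have lnm: "0 < ln (real m)" and nm: "0 < real (n m)" using elim n by auto
    have conv: "(1 - e m) * (t * ln ((real (m - k) + 1) / real k)) \<le>
        real (n m) / 2 * ln (1 + S * (real m / (real m - 1))) + ln 2"
      using support_recovery_converse[OF assms(1) elim(2,3) n[OF elim(2)] assms(3) T(2) w d[OF elim(2)] A[OF elim(2)]]
      by (simp add: e_def t_def S_def W_def)
    \<comment> \<open>Multiplying by the positive \<open>t * ln b * real (n m)\<close> clears the
      denominators and recovers the form of \<open>conv\<close>.\<close>
    have "log b (real m) / real (n m) * f m * (t * ln b * real (n m)) =
        (1 - e m) * (t * ln ((real (m - k) + 1) / real k)) - ln 2"
      using lnm nm t lnb by (simp add: f_def log_def field_simps)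
    also have "\<dots> \<le> real (n m) / 2 * ln (1 + S * (real m / (real m - 1)))"
      using conv by simp
    also have "\<dots> = C m * (t * ln b * real (n m))"
      using t lnb by (simp add: C_def)
    finally have "log b (real m) / real (n m) * f m \<le> C m"
      using t lnb nm by (simp only: mult_le_cancel_right_pos mult_pos_pos)
    then show ?case using elim(1) by (simp add: pos_le_divide_eq)
  qed
  then have "limsup (\<lambda>m. ereal (log b (real m) / real (n m))) \<le> limsup (\<lambda>m. ereal (C m / f m))"
    by (rule Limsup_mono)
  also have "\<dots> = ereal (1 / (2 * t) * log b (1 + S))"
    using lim by (intro lim_imp_Limsup) simp_all
  finally show ?thesis by (simp add: t_def S_def W_def)
qed

theorem theorem2:
  fixes k :: nat and w :: "nat \<Rightarrow> real" and \<sigma>\<^sub>a \<sigma>\<^sub>z b :: real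
    and n :: "nat \<Rightarrow> nat"
    and A :: "nat \<Rightarrow> nat \<Rightarrow> nat \<Rightarrow> real"
    and d :: "nat \<Rightarrow> (nat \<Rightarrow> real) \<Rightarrow> nat set"
  assumes "k \<ge> 1"
    and "\<And>i. i \<in> {1..k} \<Longrightarrow> w i \<noteq> 0"
    and "\<sigma>\<^sub>a > 0" and "\<sigma>\<^sub>z > 0"
    and "b > 1"
    and "\<And>m. m \<ge> k \<Longrightarrow> n m > 0"
    and "\<And>m. m \<ge> k \<Longrightarrow> support_recovery_map (n m) m (d m)"
    and "\<And>m. m \<ge> k \<Longrightarrow> 1 / (real (n m) * real m) * (frobenius_norm (n m) m (A m))\<^sup>2 \<le> \<sigma>\<^sub>a\<^sup>2"
    and "(\<lambda>m. avg_error_prob k (n m) m \<sigma>\<^sub>z w (A m) (d m)) \<longlonglongrightarrow> 0"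
  shows "limsup (\<lambda>m. ereal (log b (real m) / real (n m)))
           \<le> ereal (capacity_bound b k \<sigma>\<^sub>a \<sigma>\<^sub>z w)"
proof -
  let ?R = "\<lambda>T. 1 / (2 * real (card T)) * log b (1 + \<sigma>\<^sub>a\<^sup>2 / \<sigma>\<^sub>z\<^sup>2 * (\<Sum>j\<in>T. (w j)\<^sup>2))"
  let ?F = "{T. T \<noteq> {} \<and> T \<subseteq> {1..k}}"
  \<comment> \<open>The minimum over a finite nonempty family is attained, so the bound for a
    minimising \<open>T\<close> is enough; \<open>{1..k}\<close> witnesses nonemptiness because
    \<open>k \<ge> 1\<close>.\<close>
  have "finite ?F" by (rule finite_subset[of _ "Pow {1..k}"]) auto
  moreover have "{1..k} \<in> ?F" using assms(1) by auto
  ultimately have "capacity_bound b k \<sigma>\<^sub>a \<sigma>\<^sub>z w \<in> ?R ` ?F"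
    unfolding capacity_bound_def by (intro Min_in finite_imageI) blast+
  then obtain T where T: "T \<noteq> {}" "T \<subseteq> {1..k}" "capacity_bound b k \<sigma>\<^sub>a \<sigma>\<^sub>z w = ?R T"
    by blast
  show ?thesis
    unfolding T(3) by (rule support_recovery_rate_le[OF assms(1,2,4-9) T(1,2)])
qed

end
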